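(* For each $\Delta t>0$ and $k\in\mathbb N^*$, let $$\omega_k^h:=\frac{2}{\Delta t}\arctan\Bigl(\frac{\omega_k\Delta t}{2}\Bigr)$$ be the numerical frequency of the Crank--Nicolson scheme for $\Phi'+A\Phi=0$. Then the following hold. (i) Spectral pile-up: for each $\Delta t>0$, $\omega_k^h\in\bigl(-\tfrac{\pi}{\Delta t},\tfrac{\pi}{\Delta t}\bigr)$ for all $k\in\mathbb N^*$, while $|\omega_k|\to\infty$ as $k\to\infty$. (Thus infinitely many high-frequency continuous modes are mapped into a bounded numerical frequency band.) (ii) Unbounded phase error: $|\omega_k-\omega_k^h|\to\infty$ as $k\to\infty$. (iii) Lack of operator-norm convergence: for the fixed final time $T>0$, $$\left\|\Bigl(I+\frac{\Delta t}{2}A\Bigr)^{-\frac{T}{\Delta t}}\Bigl(I-\frac{\Delta t}{2}A\Bigr)^{\frac{T}{\Delta t}}-e^{-TA}\right\|_{\mathcal L(\mathcal E)}\not\to0\qquad\text{as }\Delta t\to0 .$$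
   Context: $\Omega=(0,1)^N$, $\alpha\ge0$ real, $\mathbb N^*=\{1,2,\dots\}$, $T>0$. $\mathcal E=H_0^1(\Omega)\times L^2(\Omega)$ (complex-valued functions) with inner product $\langle(u_1,z_1),(u_2,z_2)\rangle_{\mathcal E}=\int_\Omega(\nabla u_1\cdot\overline{\nabla u_2}+\alpha u_1\overline{u_2})dx+\int_\Omega z_1\overline{z_2}\,dx$. The operator $A$ has domain $D(A)=(H^2(\Omega)\cap H_0^1(\Omega))\times H_0^1(\Omega)$ and $A(u,z)=(-z,-\Delta u+\alpha u)$; it is skew-adjoint. It has an orthonormal basis of eigenfunctions of $\mathcal E$, namely, for $k\in(\mathbb N^* )^N$, $\phi_k^\pm=2^{-1/2}(e_k/\lambda_k^\pm,\,-e_k)$ with eigenvalues $\lambda_k^\pm=\pm\mathbf i\sqrt{\pi^2\sum_jk_j^2+\alpha}$, where $e_k(x)=2^{N/2}\prod_j\sin(k_j\pi x_j)$. These are enumerated as a single sequence $(\lambda_k,\phi_k)_{k\in\mathbb N^*}$ (multi-indices ordered by increasing $\sum_jk_j^2$, ties lexicographically, each contributing first its $+$ and then its $-$ branch), and one writes $\lambda_k=\mathbf i\omega_k$, $\omega_k\in\mathbb R$. For a function $h$ on the spectrum, $h(A)\Psi:=\sum_kh(\lambda_k)\langle\Psi,\phi_k\rangle_{\mathcal E}\phi_k$ with operator norm $\sup_k|h(\lambda_k)|$; in particular $e^{-tA}$ and the product in (iii) (the bounded operator with symbol $\bigl(\frac{1-\lambda\Delta t/2}{1+\lambda\Delta t/2}\bigr)^{T/\Delta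 t}$) are defined this way. The time steps are $\Delta t=T/n$ with $n\in\mathbb N^*$, from a uniform partition of $[0,T]$, so $T/\Delta t$ is a positive integer. The number $\omega_k^h$ is defined so that the one-step Crank--Nicolson amplification factor is $\frac{1-\mathbf i\omega_k\Delta t/2}{1+\mathbf i\omega_k\Delta t/2}=e^{-\mathbf i\omega_k^h\Delta t}$. *)

theory Defs
  imports "HOL-Analysis.Analysis" "HOL-Library.Function_Algebras"
begin

text \<open>The space dimension \<open>N\<close> is \<open>CARD('n)\<close>. A linear order on the index type \<open>'n\<close> is only needed
  for the lexicographic order on multi-indices. Functions on \<open>\<Omega>\<close> are represented by functions on the
  whole space of which only the values on \<open>\<Omega>\<close> matter, and elements of \<open>L\<^sup>2\<close>, \<open>H\<^sup>1\<close> etc. by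
  representatives up to almost everywhere equality on \<open>\<Omega>\<close>.\<close>

abbreviation \<Omega> :: "(real ^ 'n) set"
  where "\<Omega> \<equiv> box 0 1"

abbreviation M\<^sub>\<Omega> :: "(real ^ 'n) measure"
  where "M\<^sub>\<Omega> \<equiv> lebesgue_on \<Omega>"


section \<open>The energy space\<close>

definition partial :: "'n \<Rightarrow> (real ^ 'n \<Rightarrow> complex) \<Rightarrow> real ^ 'n \<Rightarrow> complex"
  where "partial j f x = frechet_derivative f (at x) (axis j 1)"

fun C_k :: "nat \<Rightarrow> (real ^ 'n \<Rightarrow> complex) \<Rightarrow> bool"
  where
    "C_k 0 f \<longleftrightarrow> continuous_on UNIV f"
  | "C_k (Suc m) f \<longleftrightarrow> (\<forall>x. f differentiable at x) \<and> (\<forall>j. C_k m (partial j f))"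

definition test_function :: "(real ^ 'n \<Rightarrow> complex) \<Rightarrow> bool"
  where "test_function f \<longleftrightarrow>
    (\<forall>m. C_k m f) \<and> compact (closure {x. f x \<noteq> 0}) \<and> closure {x. f x \<noteq> 0} \<subseteq> \<Omega>"

definition L2 :: "(real ^ 'n \<Rightarrow> complex) set"
  where "L2 = {u \<in> borel_measurable M\<^sub>\<Omega>. integrable M\<^sub>\<Omega> (\<lambda>x. (norm (u x))\<^sup>2)}"

definition is_weak_partial :: "'n \<Rightarrow> (real ^ 'n \<Rightarrow> complex) \<Rightarrow> (real ^ 'n \<Rightarrow> complex) \<Rightarrow> bool"
  where "is_weak_partial j u g \<longleftrightarrow> g \<in> L2 \<and>
    (\<forall>\<eta>. test_function \<eta> \<longrightarrow>
      (LINT x|M\<^sub>\<Omega>. u x * partial j \<eta> x) = - (LINT x|M\<^sub>\<Omega>. g x * \<eta> x))"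

definition H1 :: "(real ^ 'n \<Rightarrow> complex) set"
  where "H1 = {u \<in> L2. \<forall>j. \<exists>g. is_weak_partial j u g}"

text \<open>Weak derivatives are unique up to almost everywhere equality, so the choice is immaterial
  under integrals.\<close>

definition weak_partial :: "'n \<Rightarrow> (real ^ 'n \<Rightarrow> complex) \<Rightarrow> real ^ 'n \<Rightarrow> complex"
  where "weak_partial j u = (SOME g. is_weak_partial j u g)"

definition H1_norm :: "(real ^ 'n \<Rightarrow> complex) \<Rightarrow> real"
  where "H1_norm u = sqrt (LINT x|M\<^sub>\<Omega>. (norm (u x))\<^sup>2 + (\<Sum>j\<in>UNIV. (norm (weak_partial j u x))\<^sup>2))"

definition H10 :: "(real ^ 'n \<Rightarrow> complex) set"
  where "H10 = {u \<in> H1. \<exists>f. (\<forall>m. test_function (f m)) \<and> (\<lambda>m. H1_norm (u - f m)) \<longlonglongrightarrow> 0}"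

type_synonym 'n state = "(real ^ 'n \<Rightarrow> complex) \<times> (real ^ 'n \<Rightarrow> complex)"

definition \<E> :: "('n::finite) state set"
  where "\<E> = H10 \<times> L2"

definition E_inner :: "real \<Rightarrow> ('n::finite) state \<Rightarrow> 'n state \<Rightarrow> complex"
  where "E_inner \<alpha> \<Phi> \<Psi> =
    (LINT x|M\<^sub>\<Omega>. (\<Sum>j\<in>UNIV. weak_partial j (fst \<Phi>) x * cnj (weak_partial j (fst \<Psi>) x))
        + of_real \<alpha> * (fst \<Phi> x * cnj (fst \<Psi> x)))
    + (LINT x|M\<^sub>\<Omega>. snd \<Phi> x * cnj (snd \<Psi> x))"

definition E_norm :: "real \<Rightarrow> ('n::finite) state \<Rightarrow> real"
  where "E_norm \<alpha> \<Psi> = sqrt (Re (E_inner \<alpha> \<Psi> \<Psi>))"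

definition E_scale :: "complex \<Rightarrow> ('n::finite) state \<Rightarrow> 'n state"
  where "E_scale c \<Psi> = ((\<lambda>x. c * fst \<Psi> x), (\<lambda>x. c * snd \<Psi> x))"

text \<open>The norm of \<open>\<L>(\<E>)\<close>, with values in \<open>[0, \<infinity>]\<close>.\<close>

definition op_norm :: "real \<Rightarrow> (('n::finite) state \<Rightarrow> 'n state) \<Rightarrow> ennreal"
  where "op_norm \<alpha> B = (SUP \<Psi> \<in> {\<Psi> \<in> \<E>. E_norm \<alpha> \<Psi> \<le> 1}. ennreal (E_norm \<alpha> (B \<Psi>)))"


section \<open>Spectral data and functional calculus\<close>

type_synonym 'n multi_index = "nat ^ 'n"

definition multi_indices :: "('n::finite) multi_index set"
  where "multi_indices = {\<kappa>. \<forall>j. 1 \<le> \<kappa> $ j}"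

definition sq_sum :: "('n::finite) multi_index \<Rightarrow> nat"
  where "sq_sum \<kappa> = (\<Sum>j\<in>UNIV. (\<kappa> $ j)\<^sup>2)"

definition precedes :: "('n::{finite,linorder}) multi_index \<Rightarrow> 'n multi_index \<Rightarrow> bool"
  where "precedes \<kappa> \<mu> \<longleftrightarrow> sq_sum \<kappa> < sq_sum \<mu> \<or>
    (sq_sum \<kappa> = sq_sum \<mu> \<and> (\<exists>j. \<kappa> $ j < \<mu> $ j \<and> (\<forall>i<j. \<kappa> $ i = \<mu> $ i)))"

definition e_fun :: "('n::finite) multi_index \<Rightarrow> real ^ 'n \<Rightarrow> complex"
  where "e_fun \<kappa> x =
    of_real (2 powr (real CARD('n) / 2) * (\<Prod>j\<in>UNIV. sin (real (\<kappa> $ j) * pi * x $ j)))"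

text \<open>The sign \<open>s\<close> is \<open>1\<close> or \<open>-1\<close>, for the two branches.\<close>

definition branch_eigenvalue :: "real \<Rightarrow> ('n::finite) multi_index \<Rightarrow> real \<Rightarrow> complex"
  where "branch_eigenvalue \<alpha> \<kappa> s = of_real s * \<i> * of_real (sqrt (pi\<^sup>2 * real (sq_sum \<kappa>) + \<alpha>))"

definition branch_eigenvector :: "real \<Rightarrow> ('n::finite) multi_index \<Rightarrow> real \<Rightarrow> 'n state"
  where "branch_eigenvector \<alpha> \<kappa> s = E_scale (of_real (1 / sqrt 2))
    ((\<lambda>x. e_fun \<kappa> x / branch_eigenvalue \<alpha> \<kappa> s), (\<lambda>x. - e_fun \<kappa> x))"

text \<open>The enumeration starts at \<open>k = 1\<close>: the multi-index with exactly \<open>r\<close> predecessors yields the terms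
  \<open>k = 2r + 1\<close> (branch \<open>+\<close>) and \<open>k = 2r + 2\<close> (branch \<open>-\<close>). The value at \<open>k = 0\<close> is irrelevant.\<close>

definition nth_multi_index :: "nat \<Rightarrow> ('n::{finite,linorder}) multi_index"
  where "nth_multi_index r =
    (THE \<kappa>. \<kappa> \<in> multi_indices \<and> card {\<mu> \<in> multi_indices. precedes \<mu> \<kappa>} = r)"

definition mode_index :: "nat \<Rightarrow> ('n::{finite,linorder}) multi_index"
  where "mode_index k = nth_multi_index ((k - 1) div 2)"

definition mode_sign :: "nat \<Rightarrow> real"
  where "mode_sign k = (if odd k then 1 else - 1)"

definition eigenvalue :: "'n::{finite,linorder} itself \<Rightarrow> real \<Rightarrow> nat \<Rightarrow> complex"
  where "eigenvalue N \<alpha> k = branch_eigenvalue \<alpha> (mode_index k :: 'n multi_index) (mode_sign k)"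

definition eigenvector :: "real \<Rightarrow> nat \<Rightarrow> ('n::{finite,linorder}) state"
  where "eigenvector \<alpha> k = branch_eigenvector \<alpha> (mode_index k) (mode_sign k)"

definition \<omega> :: "'n::{finite,linorder} itself \<Rightarrow> real \<Rightarrow> nat \<Rightarrow> real"
  where "\<omega> N \<alpha> k = Im (eigenvalue N \<alpha> k)"

text \<open>\<open>spectral_op \<alpha> h\<close> is the operator \<open>h(A)\<close> on \<open>\<E>\<close>, where \<open>A (u, z) = (- z, - \<Delta> u + \<alpha> u)\<close> is the
  skew-adjoint operator with eigenpairs \<open>eigenvalue\<close>, \<open>eigenvector\<close>: its value at \<open>\<Psi>\<close> is the sum
  in \<open>\<E>\<close> of the spectral series, a limit that is unique up to almost everywhere equality.\<close>

definition spectral_op ::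
    "real \<Rightarrow> (complex \<Rightarrow> complex) \<Rightarrow> ('n::{finite,linorder}) state \<Rightarrow> 'n state"
  where "spectral_op \<alpha> h \<Psi> = (SOME \<Phi>. \<Phi> \<in> \<E> \<and>
    (\<lambda>m. E_norm \<alpha> (\<Phi> - (\<Sum>k=1..m. E_scale
        (h (eigenvalue TYPE('n) \<alpha> k) * E_inner \<alpha> \<Psi> (eigenvector \<alpha> k)) (eigenvector \<alpha> k))))
      \<longlonglongrightarrow> 0)"


section \<open>The Crank--Nicolson scheme\<close>

definition \<omega>\<^sub>h :: "'n::{finite,linorder} itself \<Rightarrow> real \<Rightarrow> real \<Rightarrow> nat \<Rightarrow> real"
  where "\<omega>\<^sub>h N \<alpha> dt k = 2 / dt * arctan (\<omega> N \<alpha> k * dt / 2)"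

text \<open>The operator \<open>(I + dt/2 A)\<^sup>-\<^sup>n (I - dt/2 A)\<^sup>n\<close>, i.e. \<open>n\<close> steps of size \<open>dt\<close>.\<close>

definition crank_nicolson ::
    "real \<Rightarrow> real \<Rightarrow> nat \<Rightarrow> ('n::{finite,linorder}) state \<Rightarrow> 'n state"
  where "crank_nicolson \<alpha> dt n =
    spectral_op \<alpha> (\<lambda>z. ((1 - z * of_real dt / 2) / (1 + z * of_real dt / 2)) ^ n)"

text \<open>The operator \<open>exp(-tA)\<close>.\<close>

definition exact_flow :: "real \<Rightarrow> real \<Rightarrow> ('n::{finite,linorder}) state \<Rightarrow> 'n state"
  where "exact_flow \<alpha> t = spectral_op \<alpha> (\<lambda>z. exp (- of_real t * z))"

end

theory Submission
  imports Defs "HOL-Real_Asymp.Real_Asymp"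
begin

text \<open>
  The frequencies satisfy \<open>\<bar>\<omega>\<^sub>k\<bar> = sqrt (pi\<^sup>2 |\<kappa>|\<^sup>2 + \<alpha>)\<close>, where \<open>\<kappa>\<close> is the multi-index of
  the mode \<open>k\<close>. Only finitely many multi-indices have bounded length and the enumeration is a bijection,
  so \<open>\<bar>\<omega>\<^sub>k\<bar>\<close> tends to infinity (\<open>omega_at_top\<close>). The numerical frequencies stay in the band
  \<open>(- pi / dt, pi / dt)\<close> because the arctangent is bounded by \<open>pi / 2\<close>, and the phase error differs
  from \<open>\<omega>\<^sub>k\<close> by at most \<open>pi / dt\<close>.

  For the failure of convergence in operator norm, fix the number \<open>n\<close> of steps. The amplification
  factor tends to \<open>-1\<close> along the spectrum (\<open>amplification_tendsto\<close>), so on modes of very high frequency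
  \<open>n\<close> steps act almost like \<open>(-1) ^ n\<close>. The exact flow does not depend on \<open>n\<close>. Hence the errors for \<open>n\<close>
  and \<open>n + 1\<close> steps, taken on the same mode, add up to almost \<open>2\<close>, and so the two operator norms add up
  to at least \<open>2\<close> (\<open>op_norm_consecutive_ge\<close>). This excludes convergence to \<open>0\<close>,
  wherever the phases \<open>exp (- T \<lambda>\<^sub>k)\<close> lie on the unit circle.

  The analytic work lies in bounding the operator norm below by the symbol
  (\<open>op_norm_spectral_diff_ge\<close>), that is, in evaluating \<open>spectral_op\<close> on an eigenvector. Three facts carry
  this. Weak derivatives are unique almost everywhere, by the fundamental lemma of the calculus of
  variations (\<open>AE_zero_if_weakly_zero\<close>), and classical derivatives are weak ones
  (\<open>is_weak_partial_classical\<close>); so inner products may be computed with explicit derivatives. The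
  eigenvectors are orthonormal, by Fubini's theorem and the orthogonality of sines and cosines
  (\<open>E_inner_eigenvectors\<close>). Finally, the eigenfunctions are limits of test functions in \<open>H\<^sup>1\<close>
  (\<open>e_fun_H10\<close>): products of sines truncated near the endpoints by smooth cutoffs, whose large
  derivatives are compensated by the zeros of the sines.
\<close>

section \<open>Smooth functions of one variable and cutoffs\<close>

text \<open>A function of one variable is recorded as smooth through finitely many witnessed derivatives, in
  parallel to the recursive predicate \<open>C_k\<close>. Smoothness itself is \<open>smooth_upto m g\<close> for every \<open>m\<close>;
  counting the order makes the closure properties plain inductions. Order \<open>0\<close> imposes nothing, so
  continuity of a derivative is read off from the next order.\<close>

fun smooth_upto :: "nat \<Rightarrow> (real \<Rightarrow> real) \<Rightarrow> bool"
  where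
    "smooth_upto 0 g \<longleftrightarrow> True"
  | "smooth_upto (Suc m) g \<longleftrightarrow>
      (\<exists>g'. (\<forall>t. (g has_real_derivative g' t) (at t)) \<and> smooth_upto m g')"

lemma smooth_upto_Suc_imp: "smooth_upto (Suc m) g \<Longrightarrow> smooth_upto m g"
proof (induction m arbitrary: g)
  case (Suc m)
  then obtain g' where "\<forall>t. (g has_real_derivative g' t) (at t)" "smooth_upto (Suc m) g'"
    by auto
  with Suc.IH[of g'] show ?case
    by auto
qed simp

lemma smooth_upto_const: "smooth_upto m (\<lambda>t. c)"
proof (induction m arbitrary: c)
  case (Suc m)
  show ?case
    using Suc[of 0] by (auto intro!: exI[of _ "\<lambda>t. 0"])
qed simp

lemma smooth_upto_add:
  "smooth_upto m f \<Longrightarrow> smooth_upto m g \<Longrightarrow> smooth_upto m (\<lambda>t. f t + g t)"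
proof (induction m arbitrary: f g)
  case (Suc m)
  then obtain f' g' where d: "\<forall>t. (f has_real_derivative f' t) (at t)" "smooth_upto m f'"
      "\<forall>t. (g has_real_derivative g' t) (at t)" "smooth_upto m g'"
    by auto
  then have "\<forall>t. ((\<lambda>t. f t + g t) has_real_derivative f' t + g' t) (at t)"
    by (auto intro!: derivative_eq_intros)
  with Suc.IH[OF d(2,4)] show ?case
    by (auto intro!: exI[of _ "\<lambda>t. f' t + g' t"])
qed simp

lemma smooth_upto_mult:
  "smooth_upto m f \<Longrightarrow> smooth_upto m g \<Longrightarrow> smooth_upto m (\<lambda>t. f t * g t)"
proof (induction m arbitrary: f g)
  case (Suc m)
  then obtain f' g' where d: "\<forall>t. (f has_real_derivative f' t) (at t)" "smooth_upto m f'"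
      "\<forall>t. (g has_real_derivative g' t) (at t)" "smooth_upto m g'"
    by auto
  then have "\<forall>t. ((\<lambda>t. f t * g t) has_real_derivative f t * g' t + f' t * g t) (at t)"
    by (auto intro!: derivative_eq_intros)
  moreover have "smooth_upto m (\<lambda>t. f t * g' t + f' t * g t)"
    using smooth_upto_Suc_imp[OF Suc.prems(1)] smooth_upto_Suc_imp[OF Suc.prems(2)] d
    by (intro smooth_upto_add Suc.IH)
  ultimately show ?case
    by (auto intro!: exI[of _ "\<lambda>t. f t * g' t + f' t * g t"])
qed simp

lemma smooth_upto_affine:
  "smooth_upto m g \<Longrightarrow> smooth_upto m (\<lambda>t. g (a * t + b))"
proof (induction m arbitrary: g)
  case (Suc m)
  then obtain g' where g: "\<forall>t. (g has_real_derivative g' t) (at t)" "smooth_upto m g'"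
    by auto
  have "((\<lambda>t. g (a * t + b)) has_real_derivative g' (a * t + b) * a) (at t)" for t
    by (rule DERIV_chain'[of "\<lambda>t. a * t + b" a t UNIV g])
       (use g in \<open>auto intro!: derivative_eq_intros\<close>)
  moreover have "smooth_upto m (\<lambda>t. g' (a * t + b) * a)"
    using g Suc.IH by (intro smooth_upto_mult smooth_upto_const) auto
  ultimately show ?case
    by (auto intro!: exI[of _ "\<lambda>t. g' (a * t + b) * a"])
qed simp

lemma smooth_upto_sin_cos: "smooth_upto m sin \<and> smooth_upto m cos"
proof (induction m)
  case (Suc m)
  have "smooth_upto m (\<lambda>t. - 1 * sin t)"
    using Suc by (intro smooth_upto_mult smooth_upto_const) auto
  with Suc show ?case
    unfolding smooth_upto.simps
    by (intro conjI exI[of _ cos] exI[of _ "\<lambda>t. - sin t"] allI DERIV_sin DERIV_cos) auto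
qed simp

text \<open>The classical family of flat functions \<open>p (1 / t) * exp (- 1 / t)\<close>, extended by \<open>0\<close> to the left.
  Admitting an arbitrary polynomial makes the family closed under differentiation, so that a single
  computation of a derivative gives smoothness of all orders.\<close>

definition flat :: "real poly \<Rightarrow> real \<Rightarrow> real"
  where "flat p t = (if t \<le> 0 then 0 else poly p (1 / t) * exp (- (1 / t)))"

lemma poly_times_exp_minus_tendsto_0: "((\<lambda>t. poly p t * exp (- t)) \<longlongrightarrow> (0::real)) at_top"
proof -
  have "((\<lambda>t. \<Sum>i\<le>degree p. coeff p i * (t ^ i / exp t)) \<longlongrightarrow> (\<Sum>i\<le>degree p. coeff p i * 0)) at_top"
    by (intro tendsto_intros tendsto_power_div_exp_0)
  moreover have "(\<lambda>t. \<Sum>i\<le>degree p. coeff p i * (t ^ i / exp t)) = (\<lambda>t. poly p t * exp (- t))"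
    by (auto simp: poly_altdef sum_distrib_right exp_minus divide_inverse mult.assoc)
  ultimately show ?thesis
    by simp
qed

lemma flat_tendsto_0_at_0: "(flat p \<longlongrightarrow> 0) (at 0)"
proof -
  have "((\<lambda>t. poly p (1 / t) * exp (- (1 / t))) \<longlongrightarrow> 0) (at_right 0)"
    using filterlim_compose[OF poly_times_exp_minus_tendsto_0[of p] filterlim_inverse_at_top_right]
    by (simp add: field_simps)
  then have "(flat p \<longlongrightarrow> 0) (at_right 0)"
    by (rule Lim_transform_eventually) (auto simp: flat_def eventually_at_filter)
  moreover have "(flat p \<longlongrightarrow> 0) (at_left 0)"
    by (rule tendsto_eventually) (auto simp: flat_def eventually_at_filter)
  ultimately show ?thesis
    using filterlim_split_at by blast
qed

text \<open>At \<open>t = 0\<close> the difference quotient of \<open>flat p\<close> is again a flat function, with the polynomial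
  multiplied by the variable, and every flat function tends to \<open>0\<close> there because exponential decay
  beats every power of \<open>1 / t\<close>.\<close>

lemma flat_has_derivative:
  "(flat p has_real_derivative flat ((p - pderiv p) * [:0, 0, 1:]) t) (at t)"
proof -
  consider "t < 0" | "t = 0" | "t > 0"
    by linarith
  then show ?thesis
  proof cases
    case 1
    have "(flat p has_real_derivative 0) (at t)"
      by (rule has_field_derivative_transform_within_open[of "\<lambda>t. 0" _ _ "{..<0}"])
         (use 1 in \<open>auto simp: flat_def\<close>)
    then show ?thesis
      using 1 by (simp add: flat_def)
  next
    case 2
    have "(\<lambda>h. flat p h / h) = flat (p * [:0, 1:])"
      by (auto simp: flat_def)
    then have "((\<lambda>h. flat p h / h) \<longlongrightarrow> 0) (at 0)"
      by (simp only: flat_tendsto_0_at_0)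
    then show ?thesis
      using 2 by (simp add: DERIV_def flat_def)
  next
    case 3
    have "((\<lambda>t. poly p (1 / t) * exp (- (1 / t))) has_real_derivative
        flat ((p - pderiv p) * [:0, 0, 1:]) t) (at t)"
      using 3 by (auto intro!: derivative_eq_intros poly_DERIV[THEN DERIV_chain2]
        simp: flat_def field_simps power2_eq_square)
    then show ?thesis
      by (rule has_field_derivative_transform_within_open[of _ _ _ "{0<..}"])
         (use 3 in \<open>auto simp: flat_def\<close>)
  qed
qed

lemma smooth_upto_flat: "smooth_upto m (flat p)"
  by (induction m arbitrary: p) (auto intro: flat_has_derivative)

text \<open>The shift by \<open>1\<close> makes \<open>cutoff m\<close> vanish up to \<open>1 / m\<close>, hence on a neighbourhood of the boundary
  point \<open>0\<close>, while it still tends to \<open>1\<close> at every \<open>t > 0\<close> as \<open>m\<close> grows.\<close>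

definition cutoff :: "nat \<Rightarrow> real \<Rightarrow> real"
  where "cutoff m t = flat 1 (real m * t - 1)"

definition cutoff_deriv :: "nat \<Rightarrow> real \<Rightarrow> real"
  where "cutoff_deriv m t = flat [:0, 0, 1:] (real m * t - 1) * real m"

lemma smooth_upto_cutoff: "smooth_upto k (cutoff m)"
  unfolding cutoff_def using smooth_upto_affine[OF smooth_upto_flat, of k 1 "real m" "-1"] by simp

lemma cutoff_has_derivative [derivative_intros]:
  "(cutoff m has_real_derivative cutoff_deriv m t) (at t)"
proof -
  have *: "(flat 1 has_real_derivative flat [:0, 0, 1:] t) (at t)" for t
    using flat_has_derivative[of 1 t] by (simp add: pderiv_1)
  have "((\<lambda>t. flat 1 (real m * t - 1)) has_real_derivative
      flat [:0, 0, 1:] (real m * t - 1) * real m) (at t)"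
    by (rule DERIV_chain'[of "\<lambda>t. real m * t - 1" _ t UNIV "flat 1"])
       (auto intro!: derivative_eq_intros *)
  then show ?thesis
    by (simp add: cutoff_def[abs_def] cutoff_deriv_def)
qed

lemma cutoff_bounds: "0 \<le> cutoff m t" "cutoff m t \<le> 1"
  by (auto simp: cutoff_def flat_def)

lemma cutoff_eq_0: "real m * t \<le> 1 \<Longrightarrow> cutoff m t = 0"
  by (simp add: cutoff_def flat_def)

lemma flat_tendsto_at_top: "(flat p \<longlongrightarrow> poly p 0) at_top"
proof -
  have "((\<lambda>s. poly p (1 / s) * exp (- (1 / s))) \<longlongrightarrow> poly p 0 * exp (- 0)) (at_top :: real filter)"
    by (intro tendsto_intros tendsto_divide_0[OF tendsto_const] filterlim_at_top_imp_at_infinity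
          filterlim_ident)
  moreover have "eventually (\<lambda>s. poly p (1 / s) * exp (- (1 / s)) = flat p s) at_top"
    using eventually_gt_at_top[of 0] by eventually_elim (auto simp: flat_def)
  ultimately show ?thesis
    by (auto intro: Lim_transform_eventually)
qed

lemma flat_dilation_tendsto:
  assumes "t > 0"
  shows "(\<lambda>m. flat p (real m * t - 1)) \<longlonglongrightarrow> poly p 0"
proof -
  have "filterlim (\<lambda>m. real m * t - 1) at_top sequentially"
    using assms by real_asymp
  then show ?thesis
    by (rule filterlim_compose[OF flat_tendsto_at_top])
qed

lemma cutoff_tendsto_1: "t > 0 \<Longrightarrow> (\<lambda>m. cutoff m t) \<longlonglongrightarrow> 1"
  using flat_dilation_tendsto[of t 1] by (simp add: cutoff_def)

lemma cutoff_deriv_times: "cutoff_deriv m t * t = flat [:0, 1, 1:] (real m * t - 1)"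
  by (auto simp: cutoff_deriv_def flat_def field_simps)

lemma cutoff_deriv_tendsto_0:
  assumes "t > 0"
  shows "(\<lambda>m. cutoff_deriv m t) \<longlonglongrightarrow> 0"
proof -
  have "(\<lambda>m. flat [:0, 1, 1:] (real m * t - 1) / t) \<longlonglongrightarrow> 0 / t"
    using flat_dilation_tendsto[OF assms, of "[:0, 1, 1:]"] assms by (intro tendsto_intros) auto
  then show ?thesis
    using assms by (simp flip: cutoff_deriv_times)
qed

text \<open>The derivative of the cutoff is of size \<open>m\<close> near the boundary, but only where \<open>t\<close> is of size
  \<open>1 / m\<close>. This uniform bound is what allows functions vanishing linearly at the boundary to be
  truncated with control of their gradients.\<close>

lemma cutoff_deriv_bound:
  assumes "t \<ge> 0"
  shows "\<bar>cutoff_deriv m t\<bar> * t \<le> 2"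
proof -
  have *: "(s + s\<^sup>2) * exp (- s) \<le> 2" if "s > 0" for s :: real
    using exp_lower_Taylor_quadratic[of s] that by (auto simp: exp_minus field_simps)
  have "0 \<le> flat [:0, 1, 1:] s \<and> flat [:0, 1, 1:] s \<le> 2" for s
  proof (cases "s > 0")
    case True
    then show ?thesis
      using *[of "1 / s"] by (simp add: flat_def power2_eq_square algebra_simps)
  qed (simp add: flat_def)
  moreover have "\<bar>cutoff_deriv m t\<bar> * t = \<bar>flat [:0, 1, 1:] (real m * t - 1)\<bar>"
    using assms by (simp add: abs_mult flip: cutoff_deriv_times)
  ultimately show ?thesis
    by (simp add: abs_le_iff)
qed

section \<open>Products of functions of one coordinate\<close>

text \<open>All functions on the cube that have to be written down (eigenfunctions, test functions, and their
  partial derivatives) are products of functions of one coordinate. A partial derivative of such a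
  product is such a product again, with one factor replaced, so that all questions of smoothness,
  convergence and integration reduce to one variable.\<close>

definition tensor :: "('n::finite \<Rightarrow> real \<Rightarrow> real) \<Rightarrow> real ^ 'n \<Rightarrow> complex"
  where "tensor g x = of_real (\<Prod>j\<in>UNIV. g j (x $ j))"

lemma partial_eqI: "(f has_derivative f') (at x) \<Longrightarrow> partial j f x = f' (axis j 1)"
  unfolding partial_def by (metis frechet_derivative_at)

lemma tensor_has_derivative:
  fixes g :: "'n::finite \<Rightarrow> real \<Rightarrow> real"
  assumes "\<And>j t. (g j has_real_derivative g' j t) (at t)"
  shows "\<exists>D. (tensor g has_derivative D) (at x) \<and> (\<forall>i. D (axis i 1) = tensor (g(i := g' i)) x)"
proof (intro exI conjI allI)
  let ?D = "\<lambda>y. complex_of_real (\<Sum>i\<in>UNIV. (g' i (x $ i) * y $ i) * (\<Prod>j\<in>UNIV - {i}. g j (x $ j)))"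
  have "((\<lambda>x. g j (x $ j)) has_derivative (\<lambda>y. g' j (x $ j) * y $ j)) (at x)" for j
  proof -
    have "((\<lambda>x. x $ j) has_derivative (\<lambda>y. y $ j)) (at x)"
      by (rule bounded_linear_imp_has_derivative) (rule bounded_linear_vec_nth)
    then show ?thesis
      using has_derivative_compose[of "\<lambda>x. x $ j" _ x UNIV "g j" "\<lambda>y. g' j (x $ j) * y"] assms
      by (auto simp: has_field_derivative_def)
  qed
  then show "(tensor g has_derivative ?D) (at x)"
    unfolding tensor_def[abs_def] by (intro has_derivative_of_real has_derivative_prod)
  fix i
  have "(\<Sum>k\<in>UNIV. (g' k (x $ k) * axis i 1 $ k) * (\<Prod>j\<in>UNIV - {k}. g j (x $ j)))
      = (\<Sum>k\<in>UNIV. if k = i then g' i (x $ i) * (\<Prod>j\<in>UNIV - {i}. g j (x $ j)) else 0)"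
    by (intro sum.cong) (auto simp: axis_def)
  also have "\<dots> = g' i (x $ i) * (\<Prod>j\<in>UNIV - {i}. g j (x $ j))"
    by simp
  also have "\<dots> = (\<Prod>j\<in>UNIV. (g(i := g' i)) j (x $ j))"
    using prod.remove[of UNIV i "\<lambda>j. (g(i := g' i)) j (x $ j)"] by simp
  finally show "?D (axis i 1) = tensor (g(i := g' i)) x"
    by (simp only: tensor_def)
qed

lemma tensor_differentiable:
  assumes "\<And>j t. (g j has_real_derivative g' j t) (at t)"
  shows "tensor g differentiable at x"
  using tensor_has_derivative[of g g' x, OF assms] by (auto simp: differentiable_def)

lemma partial_tensor:
  assumes "\<And>j t. (g j has_real_derivative g' j t) (at t)"
  shows "partial i (tensor g) = tensor (g(i := g' i))"
proof
  fix x
  obtain D where D: "(tensor g has_derivative D) (at x)" "\<forall>i. D (axis i 1) = tensor (g(i := g' i)) x"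
    using tensor_has_derivative[of g g' x, OF assms] by blast
  then show "partial i (tensor g) x = tensor (g(i := g' i)) x"
    using partial_eqI[OF D(1)] by simp
qed

lemma continuous_tensor:
  assumes "\<And>j. continuous_on UNIV (g j)"
  shows "continuous_on UNIV (tensor g)"
  unfolding tensor_def[abs_def]
  by (intro continuous_intros continuous_on_compose2[OF assms]) auto

lemma C_k_tensor:
  "(\<And>j m. smooth_upto m (g j)) \<Longrightarrow> C_k k (tensor g)"
proof (induction k arbitrary: g)
  case 0
  have "continuous_on UNIV (g j)" for j
    using 0[of "Suc 0" j] by (auto intro: DERIV_isCont continuous_at_imp_continuous_on)
  then show ?case
    by (simp add: continuous_tensor)
next
  case (Suc k)
  have "\<exists>g'. (\<forall>t. (g j has_real_derivative g' t) (at t)) \<and> (\<forall>m. smooth_upto m g')" for j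
  proof -
    obtain g' where g': "\<forall>t. (g j has_real_derivative g' t) (at t)"
      using Suc.prems[of "Suc 0" j] by auto
    \<comment> \<open>The witnesses obtained for different orders coincide, since derivatives are unique.\<close>
    moreover have "smooth_upto m g'" for m
    proof -
      obtain h where "\<forall>t. (g j has_real_derivative h t) (at t)" "smooth_upto m h"
        using Suc.prems[of "Suc m" j] by auto
      moreover from this(1) g' have "h = g'"
        by (intro ext) (meson DERIV_unique)
      ultimately show ?thesis
        by simp
    qed
    ultimately show ?thesis
      by auto
  qed
  then have "\<exists>g'. \<forall>j. (\<forall>t. (g j has_real_derivative g' j t) (at t)) \<and> (\<forall>m. smooth_upto m (g' j))"
    by (intro choice allI)
  then obtain g' where g': "\<And>j t. (g j has_real_derivative g' j t) (at t)" "\<And>j m. smooth_upto m (g' j)"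
    by blast
  have "C_k k (partial j (tensor g))" for j
    unfolding partial_tensor[OF g'(1)] by (rule Suc.IH) (use g' Suc.prems in auto)
  then show ?case
    using tensor_differentiable[of g g'] g'(1) by simp
qed

lemma test_function_tensor:
  fixes g :: "'n::finite \<Rightarrow> real \<Rightarrow> real"
  assumes "\<And>j m. smooth_upto m (g j)"
    and "0 < d" and "\<And>j t. t < d \<Longrightarrow> g j t = 0" and "\<And>j t. 1 - d < t \<Longrightarrow> g j t = 0"
  shows "test_function (tensor g)"
proof -
  have "d \<le> x $ j \<and> x $ j \<le> 1 - d" if "tensor g x \<noteq> 0" for x j
    using that assms(3)[of "x $ j" j] assms(4)[of "x $ j" j] by (force simp: tensor_def)
  then have sub: "closure {x. tensor g x \<noteq> 0} \<subseteq> cbox (\<chi> j. d) (\<chi> j. 1 - d)"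
    by (intro closure_minimal) (auto simp: mem_box_cart)
  then have "compact (closure {x. tensor g x \<noteq> 0})"
    by (metis bounded_subset bounded_cbox compact_eq_bounded_closed closed_closure)
  moreover have "cbox (\<chi> j. d) (\<chi> j. 1 - d) \<subseteq> (\<Omega> :: (real ^ 'n) set)"
  proof
    fix x :: "real ^ 'n"
    assume "x \<in> cbox (\<chi> j. d) (\<chi> j. 1 - d)"
    then have "d \<le> x $ j \<and> x $ j \<le> 1 - d" for j
      by (simp add: mem_box_cart)
    with assms(2) show "x \<in> \<Omega>"
      by (simp add: mem_box_cart) (smt (verit))
  qed
  ultimately show ?thesis
    using sub C_k_tensor[OF assms(1)] by (auto simp: test_function_def)
qed

section \<open>Square-integrable functions on the cube\<close>

lemma borel_measurable_Omega:
  "f \<in> borel_measurable borel \<Longrightarrow> f \<in> borel_measurable M\<^sub>\<Omega>"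
  by (intro measurable_restrict_space1 measurable_completion) auto

lemma continuous_measurable_Omega:
  fixes f :: "real ^ 'n \<Rightarrow> 'b::topological_space"
  shows "continuous_on UNIV f \<Longrightarrow> f \<in> borel_measurable M\<^sub>\<Omega>"
  by (intro borel_measurable_Omega borel_measurable_continuous_onI)

lemma finite_measure_Omega: "finite_measure (M\<^sub>\<Omega> :: (real ^ 'n) measure)"
proof
  have "emeasure lebesgue (\<Omega> :: (real ^ 'n) set) < \<infinity>"
    using emeasure_lborel_box_finite[of "0 :: real ^ 'n" 1] by (simp add: less_top)
  then show "emeasure M\<^sub>\<Omega> (space (M\<^sub>\<Omega> :: (real ^ 'n) measure)) \<noteq> \<infinity>"
    by (simp add: emeasure_restrict_space)
qed

lemma continuous_bounded_Omega:
  fixes f :: "real ^ 'n \<Rightarrow> 'b::real_normed_vector"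
  assumes "continuous_on UNIV f"
  shows "\<exists>C. \<forall>x\<in>\<Omega>. norm (f x) \<le> C"
proof -
  have "bounded (f ` cbox 0 1)"
    using assms by (intro compact_imp_bounded compact_continuous_image) (auto intro: continuous_on_subset)
  then show ?thesis
    using box_subset_cbox[of "0 :: real ^ 'n" 1] unfolding bounded_iff by blast
qed

lemma bounded_integrable_Omega:
  fixes f :: "real ^ 'n \<Rightarrow> 'b::{banach, second_countable_topology}"
  assumes "f \<in> borel_measurable M\<^sub>\<Omega>" and "\<And>x. x \<in> \<Omega> \<Longrightarrow> norm (f x) \<le> C"
  shows "integrable M\<^sub>\<Omega> f"
  by (rule finite_measure.integrable_const_bound[OF finite_measure_Omega _ assms(1), of C])
     (auto intro!: AE_I2 assms(2))

lemma continuous_integrable_Omega: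
  fixes f :: "real ^ 'n \<Rightarrow> 'b::{banach, second_countable_topology}"
  assumes "continuous_on UNIV f"
  shows "integrable M\<^sub>\<Omega> f"
  using continuous_bounded_Omega[OF assms] bounded_integrable_Omega[OF continuous_measurable_Omega[OF assms]]
  by blast

lemma L2_measurable: "u \<in> L2 \<Longrightarrow> u \<in> borel_measurable M\<^sub>\<Omega>"
  by (simp add: L2_def)

lemma L2_continuous: "continuous_on UNIV u \<Longrightarrow> u \<in> L2"
  unfolding L2_def
  by (auto intro!: continuous_measurable_Omega continuous_integrable_Omega continuous_intros)

lemma L2_mult_integrable:
  assumes "u \<in> L2" "v \<in> L2"
  shows "integrable M\<^sub>\<Omega> (\<lambda>x. u x * v x)"
proof (rule Bochner_Integration.integrable_bound)
  show "integrable M\<^sub>\<Omega> (\<lambda>x. (norm (u x))\<^sup>2 + (norm (v x))\<^sup>2)"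
    using assms by (auto simp: L2_def)
  show "(\<lambda>x. u x * v x) \<in> borel_measurable M\<^sub>\<Omega>"
    using assms by (auto simp: L2_def)
  have "a * b \<le> a\<^sup>2 + b\<^sup>2" if "0 \<le> a" "0 \<le> b" for a b :: real
    using sum_squares_bound[of a b] mult_nonneg_nonneg[OF that] by linarith
  then show "AE x in M\<^sub>\<Omega>. norm (u x * v x) \<le> norm ((norm (u x))\<^sup>2 + (norm (v x))\<^sup>2)"
    by (auto simp: norm_mult)
qed

lemma L2_cnj: "u \<in> L2 \<Longrightarrow> (\<lambda>x. cnj (u x)) \<in> L2"
  using measurable_compose[OF L2_measurable borel_measurable_continuous_onI[of cnj]]
  by (auto simp: L2_def intro: continuous_intros)

lemma L2_scale: "u \<in> L2 \<Longrightarrow> (\<lambda>x. c * u x) \<in> L2"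
  by (auto simp: L2_def norm_mult power_mult_distrib)

lemma L2_add:
  assumes "u \<in> L2" "v \<in> L2"
  shows "(\<lambda>x. u x + v x) \<in> L2"
proof -
  have "integrable M\<^sub>\<Omega> (\<lambda>x. (norm (u x + v x))\<^sup>2)"
  proof (rule Bochner_Integration.integrable_bound)
    show "integrable M\<^sub>\<Omega> (\<lambda>x. 2 * (norm (u x))\<^sup>2 + 2 * (norm (v x))\<^sup>2)"
      using assms by (auto simp: L2_def)
    show "(\<lambda>x. (norm (u x + v x))\<^sup>2) \<in> borel_measurable M\<^sub>\<Omega>"
      using assms by (auto simp: L2_def)
    have "(norm (a + b))\<^sup>2 \<le> 2 * (norm a)\<^sup>2 + 2 * (norm b)\<^sup>2" for a b :: complex
    proof -
      have "(norm (a + b))\<^sup>2 \<le> (norm a + norm b)\<^sup>2"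
        by (intro power_mono norm_triangle_ineq) auto
      then show ?thesis
        using sum_squares_bound[of "norm a" "norm b"] by (simp add: power2_sum)
    qed
    then show "AE x in M\<^sub>\<Omega>. norm ((norm (u x + v x))\<^sup>2) \<le> norm (2 * (norm (u x))\<^sup>2 + 2 * (norm (v x))\<^sup>2)"
      by auto
  qed
  then show ?thesis
    using assms by (auto simp: L2_def)
qed

lemma L2_diff: "u \<in> L2 \<Longrightarrow> v \<in> L2 \<Longrightarrow> (\<lambda>x. u x - v x) \<in> L2"
  using L2_add[OF _ L2_scale[of v "-1"], of u] by simp

lemma test_function_L2: "test_function \<eta> \<Longrightarrow> \<eta> \<in> L2"
  using L2_continuous unfolding test_function_def by (metis C_k.simps(1))

lemma test_function_partial_L2: "test_function \<eta> \<Longrightarrow> partial j \<eta> \<in> L2"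
  using L2_continuous unfolding test_function_def by (metis C_k.simps)

lemma is_weak_partial_linear:
  assumes "is_weak_partial j u g" "is_weak_partial j v h" "u \<in> L2" "v \<in> L2"
  shows "is_weak_partial j (\<lambda>x. a * u x + b * v x) (\<lambda>x. a * g x + b * h x)"
  unfolding is_weak_partial_def
proof (intro conjI allI impI)
  have L: "g \<in> L2" "h \<in> L2"
    using assms by (auto simp: is_weak_partial_def)
  then show "(\<lambda>x. a * g x + b * h x) \<in> L2"
    by (intro L2_add L2_scale)
  fix \<eta> :: "real ^ 'a \<Rightarrow> complex"
  assume \<eta>: "test_function \<eta>"
  have split: "(LINT x|M\<^sub>\<Omega>. (a * p x + b * q x) * r x)
      = a * (LINT x|M\<^sub>\<Omega>. p x * r x) + b * (LINT x|M\<^sub>\<Omega>. q x * r x)"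
    if "p \<in> L2" "q \<in> L2" "r \<in> L2" for p q r :: "real ^ 'a \<Rightarrow> complex"
    using L2_mult_integrable[OF that(1,3)] L2_mult_integrable[OF that(2,3)]
    by (simp add: distrib_right mult.assoc)
  show "(LINT x|M\<^sub>\<Omega>. (a * u x + b * v x) * partial j \<eta> x) = - (LINT x|M\<^sub>\<Omega>. (a * g x + b * h x) * \<eta> x)"
    using assms(1,2) \<eta>
    by (simp add: split L assms(3,4) test_function_L2 test_function_partial_L2 is_weak_partial_def)
qed

section \<open>Uniqueness of weak derivatives\<close>

text \<open>Sets measurable for \<open>M\<^sub>\<Omega>\<close> are Lebesgue sets, whereas the hypothesis covers Borel sets
  only. Passing to a Borel representative of the function on the whole space bridges the gap.\<close>

lemma AE_zero_if_borel_integrals_zero: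
  fixes f :: "real ^ 'n \<Rightarrow> real"
  assumes f: "integrable M\<^sub>\<Omega> f"
    and zero: "\<And>A. A \<in> sets borel \<Longrightarrow> (LINT x|M\<^sub>\<Omega>. indicator A x * f x) = 0"
  shows "AE x in M\<^sub>\<Omega>. f x = 0"
proof -
  let ?F = "\<lambda>x. indicator \<Omega> x * f x"
  have F: "integrable lebesgue ?F"
    using f by (simp add: integrable_restrict_space)
  obtain F' where F'[measurable]: "F' \<in> borel_measurable lborel" and eq: "AE x in lborel. ?F x = F' x"
    using completion_ex_borel_measurable_real[OF borel_measurable_integrable[OF F]] by auto
  have eq': "AE x in lebesgue. ?F x = F' x"
    using AE_completion[OF eq] .
  have "integrable lebesgue F'"
    using integrable_cong_AE[OF borel_measurable_integrable[OF F] measurable_completion[OF F'] eq'] F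
    by simp
  then have int: "integrable lborel F'"
    by (simp add: integrable_completion)
  have "AE x in lborel. F' x = 0"
  proof (rule density_unique_real[OF int])
    fix A :: "(real ^ 'n) set"
    assume A: "A \<in> sets lborel"
    then have [measurable]: "A \<in> sets borel"
      by simp
    have "(LINT x:A|lborel. F' x) = (LINT x|lebesgue. indicator A x * F' x)"
      by (subst integral_completion) (auto simp: set_lebesgue_integral_def)
    also have "\<dots> = (LINT x|lebesgue. indicator A x * ?F x)"
      using F by (intro integral_cong_AE borel_measurable_times measurable_completion
          borel_measurable_integrable[OF F]) (use eq' in auto)
    also have "\<dots> = (LINT x|M\<^sub>\<Omega>. indicator A x * f x)"
      by (simp add: integral_restrict_space mult_ac)
    also have "\<dots> = 0"
      using zero A by simp
    finally show "(LINT x:A|lborel. F' x) = (LINT x:A|lborel. 0)"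
      by simp
  qed simp
  then have "AE x in lebesgue. ?F x = 0"
    using eq' AE_completion[of "\<lambda>x. F' x = 0" lborel] by auto
  then show ?thesis
    by (auto simp: AE_restrict_space_iff)
qed

text \<open>The indicator of a box is the pointwise limit of products of cutoffs, which are test functions
  bounded by \<open>1\<close>, so the integral over the box is a limit of zeros by dominated convergence.\<close>

lemma integral_box_eq_0_if_weakly_zero:
  fixes g :: "real ^ 'n \<Rightarrow> complex"
  assumes g: "integrable M\<^sub>\<Omega> g"
    and zero: "\<And>\<eta>. test_function \<eta> \<Longrightarrow> (LINT x|M\<^sub>\<Omega>. g x * \<eta> x) = 0"
  shows "(LINT x|M\<^sub>\<Omega>. indicator (box a b) x *\<^sub>R g x) = 0"
proof -
  \<comment> \<open>The box is first intersected with the cube, so that the approximants are supported in the cube.\<close>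
  define a' b' where "a' j = max 0 (a $ j)" and "b' j = min 1 (b $ j)" for j
  define \<eta> where "\<eta> m = tensor (\<lambda>j t. cutoff (Suc m) (t - a' j) * cutoff (Suc m) (b' j - t))" for m
  have test: "test_function (\<eta> m)" for m
    unfolding \<eta>_def
  proof (rule test_function_tensor)
    fix j k
    show "smooth_upto k (\<lambda>t. cutoff (Suc m) (t - a' j) * cutoff (Suc m) (b' j - t))"
      using smooth_upto_affine[OF smooth_upto_cutoff, of k "Suc m" 1 "- a' j"]
        smooth_upto_affine[OF smooth_upto_cutoff, of k "Suc m" "-1" "b' j"]
      by (intro smooth_upto_mult) auto
    show "0 < 1 / real (Suc m)"
      by simp
    fix t :: real
    show "cutoff (Suc m) (t - a' j) * cutoff (Suc m) (b' j - t) = 0" if "t < 1 / real (Suc m)"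
    proof -
      have "real (Suc m) * (t - a' j) \<le> real (Suc m) * (1 / real (Suc m))"
        using that by (intro mult_left_mono) (auto simp: a'_def)
      then show ?thesis
        by (simp add: cutoff_eq_0)
    qed
    show "cutoff (Suc m) (t - a' j) * cutoff (Suc m) (b' j - t) = 0" if "1 - 1 / real (Suc m) < t"
    proof -
      have "real (Suc m) * (b' j - t) \<le> real (Suc m) * (1 / real (Suc m))"
        using that by (intro mult_left_mono) (auto simp: b'_def)
      then show ?thesis
        by (simp add: cutoff_eq_0)
    qed
  qed
  have "(\<lambda>m. LINT x|M\<^sub>\<Omega>. g x * \<eta> m x) \<longlonglongrightarrow> (LINT x|M\<^sub>\<Omega>. indicator (box a b) x *\<^sub>R g x)"
  proof (rule integral_dominated_convergence[where w="\<lambda>x. norm (g x)"])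
    show "(\<lambda>x. indicator (box a b) x *\<^sub>R g x) \<in> borel_measurable M\<^sub>\<Omega>"
      using g by (intro borel_measurable_scaleR borel_measurable_Omega[of "indicator _"]) auto
    show "(\<lambda>x. g x * \<eta> m x) \<in> borel_measurable M\<^sub>\<Omega>" for m
      using g L2_measurable[OF test_function_L2[OF test]] by auto
    show "integrable M\<^sub>\<Omega> (\<lambda>x. norm (g x))"
      using g by simp
    have "norm (\<eta> m x) \<le> 1" for m x
    proof -
      have "(\<Prod>j\<in>UNIV. \<bar>cutoff (Suc m) (x $ j - a' j) * cutoff (Suc m) (b' j - x $ j)\<bar>) \<le> 1"
        by (intro prod_le_1) (auto simp: abs_mult cutoff_bounds abs_of_nonneg intro!: mult_le_one)
      then show ?thesis
        by (simp add: \<eta>_def tensor_def norm_of_real abs_prod del: of_real_prod)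
    qed
    then show "AE x in M\<^sub>\<Omega>. norm (g x * \<eta> m x) \<le> norm (g x)" for m
      by (simp add: norm_mult mult_left_le)
    have "(\<lambda>m. g x * \<eta> m x) \<longlonglongrightarrow> indicator (box a b) x *\<^sub>R g x" if x: "x \<in> \<Omega>" for x
    proof (cases "x \<in> box a b")
      case True
      then have "a' j < x $ j" "x $ j < b' j" for j
        using x by (auto simp: mem_box_cart a'_def b'_def)
      then have "(\<lambda>m. cutoff (Suc m) (x $ j - a' j)) \<longlonglongrightarrow> 1" "(\<lambda>m. cutoff (Suc m) (b' j - x $ j)) \<longlonglongrightarrow> 1" for j
        by (auto intro!: LIMSEQ_Suc[OF cutoff_tendsto_1])
      then have "(\<lambda>m. g x * \<eta> m x) \<longlonglongrightarrow> g x * of_real (\<Prod>j\<in>(UNIV::'n set). 1 * 1)"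
        unfolding \<eta>_def tensor_def by (intro tendsto_intros)
      then show ?thesis
        using True by simp
    next
      case False
      then obtain j where "x $ j \<le> a $ j \<or> b $ j \<le> x $ j"
        by (auto simp: mem_box_cart not_less)
      then have "x $ j \<le> a' j \<or> b' j \<le> x $ j"
        by (auto simp: a'_def b'_def)
      then have "real (Suc m) * (x $ j - a' j) \<le> 1 \<or> real (Suc m) * (b' j - x $ j) \<le> 1" for m
        by (smt (verit) mult_nonneg_nonpos of_nat_0_le_iff)
      then have "\<exists>j. cutoff (Suc m) (x $ j - a' j) * cutoff (Suc m) (b' j - x $ j) = 0" for m
        using cutoff_eq_0 by (metis mult_eq_0_iff)
      then have "\<eta> m x = 0" for m
        unfolding \<eta>_def tensor_def of_real_eq_0_iff prod_zero_iff[OF finite] by simp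
      then show ?thesis
        using False by simp
    qed
    then show "AE x in M\<^sub>\<Omega>. (\<lambda>m. g x * \<eta> m x) \<longlonglongrightarrow> indicator (box a b) x *\<^sub>R g x"
      by (intro AE_I2) simp
  qed
  then show ?thesis
    using LIMSEQ_unique[OF tendsto_const[of 0]] by (simp add: zero[OF test])
qed

text \<open>The fundamental lemma of the calculus of variations. Boxes form an intersection-stable generator
  of the Borel sets, and the sets over which the integral vanishes form a Dynkin system; hence all
  integrals over Borel sets vanish.\<close>

lemma AE_zero_if_weakly_zero:
  fixes g :: "real ^ 'n \<Rightarrow> complex"
  assumes g: "integrable M\<^sub>\<Omega> g"
    and zero: "\<And>\<eta>. test_function \<eta> \<Longrightarrow> (LINT x|M\<^sub>\<Omega>. g x * \<eta> x) = 0"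
  shows "AE x in M\<^sub>\<Omega>. g x = 0"
proof -
  note ind[simp] = borel_measurable_Omega[OF borel_measurable_indicator]
  have intA: "integrable M\<^sub>\<Omega> (\<lambda>x. indicator A x *\<^sub>R g x)" if "A \<in> sets borel" for A
  proof (rule Bochner_Integration.integrable_bound[OF g])
    show "(\<lambda>x. indicator A x *\<^sub>R g x) \<in> borel_measurable M\<^sub>\<Omega>"
      by (intro borel_measurable_scaleR ind that borel_measurable_integrable g)
  qed (auto simp: indicator_def)
  have null: "(LINT x|M\<^sub>\<Omega>. indicator A x *\<^sub>R g x) = 0" if A: "A \<in> sets borel" for A
  proof -
    let ?G = "range (\<lambda>(a, b). box a b :: (real ^ 'n) set)"
    have borel: "sets borel = sigma_sets UNIV ?G"
      by (simp add: borel_eq_box)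
    have "Int_stable ?G"
      by (auto simp: Int_stable_def box_Int_box)
    moreover have "?G \<subseteq> Pow UNIV" "A \<in> sigma_sets UNIV ?G"
      using A borel by simp_all
    ultimately show ?thesis
    proof (induction rule: sigma_sets_induct_disjoint)
      case (basic A)
      then show ?case
        using integral_box_eq_0_if_weakly_zero[OF g zero] by auto
    next
      case (compl A)
      have "(LINT x|M\<^sub>\<Omega>. g x) = (LINT x|M\<^sub>\<Omega>. indicator (box 0 1) x *\<^sub>R g x)"
        by (rule Bochner_Integration.integral_cong) auto
      also have "\<dots> = 0"
        by (rule integral_box_eq_0_if_weakly_zero[OF g zero])
      finally have "(LINT x|M\<^sub>\<Omega>. g x - indicator A x *\<^sub>R g x) = 0"
        using compl intA[of A] g borel by simp
      also have "(\<lambda>x. g x - indicator A x *\<^sub>R g x) = (\<lambda>x. indicator (UNIV - A) x *\<^sub>R g x)"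
        by (auto simp: indicator_def)
      finally show ?case .
    next
      case (union F)
      then have F: "F i \<in> sets borel" for i
        using borel by auto
      have "(\<lambda>n. LINT x|M\<^sub>\<Omega>. indicator (\<Union>i<n. F i) x *\<^sub>R g x)
          \<longlonglongrightarrow> (LINT x|M\<^sub>\<Omega>. indicator (\<Union>(range F)) x *\<^sub>R g x)"
      proof (rule integral_dominated_convergence[where w="\<lambda>x. norm (g x)"])
        show "AE x in M\<^sub>\<Omega>. (\<lambda>n. indicator (\<Union>i<n. F i) x *\<^sub>R g x) \<longlonglongrightarrow> indicator (\<Union>(range F)) x *\<^sub>R g x"
          by (intro AE_I2 tendsto_intros LIMSEQ_indicator_UN)
        show "(\<lambda>x. indicator (\<Union>(range F)) x *\<^sub>R g x) \<in> borel_measurable M\<^sub>\<Omega>"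
          using F by (intro borel_measurable_integrable intA) auto
        show "(\<lambda>x. indicator (\<Union>i<n. F i) x *\<^sub>R g x) \<in> borel_measurable M\<^sub>\<Omega>" for n
          using F by (intro borel_measurable_integrable intA) auto
      qed (use g in \<open>auto simp: indicator_def\<close>)
      moreover have "(LINT x|M\<^sub>\<Omega>. indicator (\<Union>i<n. F i) x *\<^sub>R g x) = 0" for n
      proof -
        have "disjoint_family_on F {..<n}"
          using union(1) by (auto simp: disjoint_family_on_def)
        then have "(\<lambda>x. indicator (\<Union>i<n. F i) x *\<^sub>R g x) = (\<lambda>x. \<Sum>i<n. indicator (F i) x *\<^sub>R g x)"
          by (auto simp: indicator_UN_disjoint scaleR_sum_left)
        then have "(LINT x|M\<^sub>\<Omega>. indicator (\<Union>i<n. F i) x *\<^sub>R g x)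
            = (\<Sum>i<n. LINT x|M\<^sub>\<Omega>. indicator (F i) x *\<^sub>R g x)"
          using intA[OF F] by (simp only: Bochner_Integration.integral_sum)
        moreover have "(LINT x|M\<^sub>\<Omega>. indicator (F i) x *\<^sub>R g x) = 0" for i
          using union F[of i] borel by blast
        ultimately show ?thesis
          by simp
      qed
      ultimately show ?case
        using LIMSEQ_unique[OF tendsto_const[of 0]] by simp
    qed simp_all
  qed
  have "AE x in M\<^sub>\<Omega>. Re (g x) = 0"
  proof (rule AE_zero_if_borel_integrals_zero)
    fix A :: "(real ^ 'n) set"
    assume "A \<in> sets borel"
    then show "(LINT x|M\<^sub>\<Omega>. indicator A x * Re (g x)) = 0"
      using integral_Re[OF intA] null by simp
  qed (use g in simp)
  moreover have "AE x in M\<^sub>\<Omega>. Im (g x) = 0"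
  proof (rule AE_zero_if_borel_integrals_zero)
    fix A :: "(real ^ 'n) set"
    assume "A \<in> sets borel"
    then show "(LINT x|M\<^sub>\<Omega>. indicator A x * Im (g x)) = 0"
      using integral_Im[OF intA] null by simp
  qed (use g in simp)
  ultimately show ?thesis
    by eventually_elim (simp add: complex_eq_iff)
qed

lemma weak_partial_unique:
  assumes "is_weak_partial j u g" "is_weak_partial j u h"
  shows "AE x in M\<^sub>\<Omega>. g x = h x"
proof -
  have L: "g \<in> L2" "h \<in> L2"
    using assms by (auto simp: is_weak_partial_def)
  have one: "(\<lambda>x. 1) \<in> L2"
    by (rule L2_continuous) simp
  have "AE x in M\<^sub>\<Omega>. g x - h x = 0"
  proof (rule AE_zero_if_weakly_zero)
    show "integrable M\<^sub>\<Omega> (\<lambda>x. g x - h x)"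
      using L2_mult_integrable[OF L2_diff[OF L] one] by simp
    fix \<eta> :: "real ^ 'a \<Rightarrow> complex"
    assume \<eta>: "test_function \<eta>"
    then have "(LINT x|M\<^sub>\<Omega>. g x * \<eta> x) = (LINT x|M\<^sub>\<Omega>. h x * \<eta> x)"
      using assms by (simp add: is_weak_partial_def)
    then show "(LINT x|M\<^sub>\<Omega>. (g x - h x) * \<eta> x) = 0"
      using L2_mult_integrable[OF L(1) test_function_L2[OF \<eta>]]
        L2_mult_integrable[OF L(2) test_function_L2[OF \<eta>]]
      by (simp add: left_diff_distrib)
  qed
  then show ?thesis
    by simp
qed

text \<open>Weak derivatives are chosen by Hilbert choice. This lemma identifies the chosen one, almost
  everywhere, with any derivative known explicitly.\<close>

lemma weak_partial_eqI:
  assumes "is_weak_partial j u g"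
  shows "is_weak_partial j u (weak_partial j u)" and "AE x in M\<^sub>\<Omega>. weak_partial j u x = g x"
proof -
  show *: "is_weak_partial j u (weak_partial j u)"
    unfolding weak_partial_def by (rule someI[of "is_weak_partial j u", OF assms])
  show "AE x in M\<^sub>\<Omega>. weak_partial j u x = g x"
    by (rule weak_partial_unique[OF * assms])
qed

section \<open>Integration by parts and Fubini on the cube\<close>

text \<open>By translation invariance of Lebesgue measure every difference quotient of \<open>\<psi>\<close> in the direction
  \<open>e\<close> has integral \<open>0\<close>. The quotients are bounded by the maximum of the derivative and supported in a
  common ball, so their limit, the directional derivative, has integral \<open>0\<close> as well.\<close>

lemma integral_partial_compact_support:
  fixes \<psi> :: "real ^ 'n \<Rightarrow> complex"
  assumes D: "\<And>x. (\<psi> has_derivative D x) (at x)"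
    and cont: "continuous_on UNIV (\<lambda>x. D x e)"
    and K: "compact K" "\<And>x. x \<notin> K \<Longrightarrow> \<psi> x = 0"
  shows "(LINT x|lborel. D x e) = 0"
proof -
  obtain R where R: "K \<subseteq> cball 0 R"
    using compact_imp_bounded[OF K(1)] unfolding bounded_iff by (auto simp: subset_iff)
  have D0: "D x e = 0" if "x \<notin> K" for x
  proof -
    have "(\<psi> has_derivative (\<lambda>_. 0)) (at x)"
      by (rule has_derivative_transform_within_open[of "\<lambda>_. 0" _ _ _ "- K"])
         (use K that in \<open>auto intro: compact_imp_closed\<close>)
    then have "D x = (\<lambda>_. 0)"
      using D has_derivative_unique by blast
    then show ?thesis
      by simp
  qed
  have "bounded ((\<lambda>x. D x e) ` K)"
    using K(1) cont by (intro compact_imp_bounded compact_continuous_image) (auto intro: continuous_on_subset)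
  then obtain B0 where B0: "\<And>x. x \<in> K \<Longrightarrow> norm (D x e) \<le> B0"
    unfolding bounded_iff by blast
  define B where "B = max B0 0"
  have B: "norm (D x e) \<le> B" for x
    using B0[of x] D0[of x] by (cases "x \<in> K") (auto simp: B_def)
  \<comment> \<open>Mean value inequality along the segment in direction \<open>e\<close>.\<close>
  have step: "norm (\<psi> (x + h *\<^sub>R e) - \<psi> x) \<le> B * h" if "h \<ge> 0" for x h
  proof -
    have "((\<lambda>s. \<psi> (x + s *\<^sub>R e)) has_derivative (\<lambda>s. s *\<^sub>R D (x + t *\<^sub>R e) e)) (at t within {0..h})" for t
    proof -
      have "((\<lambda>s. x + s *\<^sub>R e) has_derivative (\<lambda>s. s *\<^sub>R e)) (at t within {0..h})"
        by (auto intro!: derivative_eq_intros)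
      from has_derivative_compose[OF this D] show ?thesis
        by (simp add: linear_scale[OF has_derivative_linear[OF D]])
    qed
    from differentiable_bound[OF convex_real_interval(5) this, of B h 0] that
    show ?thesis
      using B by (auto simp: onorm_scaleR_left[OF bounded_linear_ident] onorm_id)
  qed
  let ?h = "\<lambda>m. 1 / real (Suc m)"
  define q where "q m x = (\<psi> (x + ?h m *\<^sub>R e) - \<psi> x) /\<^sub>R ?h m" for m x
  have psi_cont: "continuous_on UNIV \<psi>"
    by (intro continuous_at_imp_continuous_on ballI has_derivative_continuous[OF D])
  have psi_int: "integrable lborel (\<lambda>x. \<psi> (a + x))" for a
  proof -
    have "integrable lborel (\<lambda>x. indicator K x *\<^sub>R \<psi> x)"
      using borel_integrable_compact[OF K(1)] continuous_on_subset[OF psi_cont] by auto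
    also have "(\<lambda>x. indicator K x *\<^sub>R \<psi> x) = \<psi>"
      using K(2) by (auto simp: indicator_def)
    finally have "integrable (distr lborel borel ((+) a)) \<psi>"
      by (simp add: lborel_distr_plus)
    then show ?thesis
      by (subst (asm) integrable_distr_eq) (auto intro: borel_measurable_continuous_onI psi_cont)
  qed
  have psi_translate: "(LINT x|lborel. \<psi> (a + x)) = (LINT x|lborel. \<psi> x)" for a
    using integral_distr[of "(+) a" lborel borel \<psi>] borel_measurable_continuous_onI[OF psi_cont]
    by (simp add: lborel_distr_plus)
  have q_int: "(LINT x|lborel. q m x) = 0" for m
  proof -
    have "(LINT x|lborel. \<psi> (?h m *\<^sub>R e + x) - \<psi> x) = 0"
      using psi_int[of "?h m *\<^sub>R e"] psi_int[of 0] psi_translate[of "?h m *\<^sub>R e"] by simp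
    then show ?thesis
      unfolding q_def by (simp add: add.commute)
  qed
  have "(\<lambda>m. LINT x|lborel. q m x) \<longlonglongrightarrow> (LINT x|lborel. D x e)"
  proof (rule integral_dominated_convergence[where w="\<lambda>x. indicator (cball 0 (R + norm e)) x *\<^sub>R B"])
    show "(\<lambda>x. D x e) \<in> borel_measurable lborel"
      using borel_measurable_continuous_onI[OF cont] by simp
    have "continuous_on UNIV (\<lambda>x. \<psi> (x + ?h m *\<^sub>R e))" for m
      by (intro continuous_on_compose2[OF psi_cont] continuous_intros) auto
    then have "continuous_on UNIV (q m)" for m
      unfolding q_def[abs_def] by (intro continuous_intros psi_cont)
    from borel_measurable_continuous_onI[OF this] show "q m \<in> borel_measurable lborel" for m
      by simp
    show "integrable lborel (\<lambda>x. indicator (cball 0 (R + norm e)) x *\<^sub>R B)"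
      by (intro borel_integrable_compact compact_cball continuous_intros)
    have "norm (q m x) \<le> indicator (cball 0 (R + norm e)) x *\<^sub>R B" for m x
    proof (cases "x \<in> cball 0 (R + norm e)")
      case True
      then show ?thesis
        using mult_left_mono[OF step[of "?h m" x], of "real (Suc m)"] by (simp add: q_def)
    next
      case False
      have "norm x \<le> norm (x + ?h m *\<^sub>R e) + norm (?h m *\<^sub>R e)"
        using norm_triangle_ineq4[of "x + ?h m *\<^sub>R e" "?h m *\<^sub>R e"] by simp
      also have "norm (?h m *\<^sub>R e) \<le> norm e"
        using mult_right_mono[of "?h m" 1 "norm e"] by simp
      finally have "x + ?h m *\<^sub>R e \<notin> K" "x \<notin> K"
        using False R by (auto simp: subset_iff) (smt (verit) norm_ge_zero)+
      then show ?thesis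
        using K(2) False by (simp add: q_def)
    qed
    then show "AE x in lborel. norm (q m x) \<le> indicator (cball 0 (R + norm e)) x *\<^sub>R B" for m
      by simp
    have "(\<lambda>m. q m x) \<longlonglongrightarrow> D x e" for x
    proof -
      have "((\<lambda>s. \<psi> (x + s *\<^sub>R e)) has_vector_derivative D x e) (at 0)"
      proof -
        have "((\<lambda>s. x + s *\<^sub>R e) has_derivative (\<lambda>s. s *\<^sub>R e)) (at 0)"
          by (auto intro!: derivative_eq_intros)
        from has_derivative_compose[OF this, of \<psi> "D x"] show ?thesis
          using D[of x] by (simp add: linear_scale[OF has_derivative_linear[OF D]] has_vector_derivative_def)
      qed
      then have "((\<lambda>h. norm (\<psi> (x + h *\<^sub>R e) - \<psi> x - h *\<^sub>R D x e) / norm h) \<longlongrightarrow> 0) (at 0)"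
        by (simp add: has_vector_derivative_def has_derivative_at)
      moreover have "filterlim ?h (at 0) sequentially"
        using LIMSEQ_inverse_real_of_nat by (auto simp: filterlim_at inverse_eq_divide)
      ultimately have "(\<lambda>m. norm (\<psi> (x + ?h m *\<^sub>R e) - \<psi> x - ?h m *\<^sub>R D x e) / norm (?h m)) \<longlonglongrightarrow> 0"
        by (rule filterlim_compose)
      also have "(\<lambda>m. norm (\<psi> (x + ?h m *\<^sub>R e) - \<psi> x - ?h m *\<^sub>R D x e) / norm (?h m))
          = (\<lambda>m. norm (q m x - D x e))"
      proof
        fix m
        have "q m x - D x e = (\<psi> (x + ?h m *\<^sub>R e) - \<psi> x - ?h m *\<^sub>R D x e) /\<^sub>R ?h m"
          by (simp add: q_def scaleR_diff_right)
        then show "norm (\<psi> (x + ?h m *\<^sub>R e) - \<psi> x - ?h m *\<^sub>R D x e) / norm (?h m) = norm (q m x - D x e)"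
          by (simp add: divide_inverse mult.commute)
      qed
      finally show ?thesis
        using Lim_null tendsto_norm_zero_iff by blast
    qed
    then show "AE x in lborel. (\<lambda>m. q m x) \<longlonglongrightarrow> D x e"
      by simp
  qed
  then show ?thesis
    using LIMSEQ_unique[OF tendsto_const[of 0]] by (simp add: q_int)
qed

text \<open>Integration by parts: the product with a test function has compact support, and its derivative
  has integral \<open>0\<close>.\<close>

lemma is_weak_partial_classical:
  fixes u :: "real ^ 'n \<Rightarrow> complex"
  assumes u: "\<And>x. u differentiable at x" and cont: "continuous_on UNIV (partial j u)"
  shows "is_weak_partial j u (partial j u)"
  unfolding is_weak_partial_def
proof (intro conjI allI impI)
  show L: "partial j u \<in> L2"
    using cont by (rule L2_continuous)
  have u_cont: "continuous_on UNIV u"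
    using u differentiable_imp_continuous_within continuous_at_imp_continuous_on by blast
  fix \<eta> :: "real ^ 'n \<Rightarrow> complex"
  assume \<eta>: "test_function \<eta>"
  then have "C_k 0 \<eta>" "C_k (Suc 0) \<eta>"
    unfolding test_function_def by blast+
  then have diff: "\<And>x. \<eta> differentiable at x"
    and conts: "continuous_on UNIV \<eta>" "continuous_on UNIV (partial j \<eta>)"
    by auto
  let ?K = "closure {x. \<eta> x \<noteq> 0}"
  have K: "compact ?K" "?K \<subseteq> \<Omega>"
    using \<eta> by (auto simp: test_function_def)
  have out: "\<eta> x = 0" if "x \<notin> ?K" for x
    using that closure_subset[of "{x. \<eta> x \<noteq> 0}"] by blast
  define D where "D x = (\<lambda>h. u x * frechet_derivative \<eta> (at x) h + frechet_derivative u (at x) h * \<eta> x)" for x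
  have D: "((\<lambda>x. u x * \<eta> x) has_derivative D x) (at x)" for x
    unfolding D_def
    by (intro has_derivative_mult frechet_derivative_works[THEN iffD1] u diff)
  have De: "D x (axis j 1) = u x * partial j \<eta> x + partial j u x * \<eta> x" for x
    by (simp add: D_def partial_def)
  have zero: "D x (axis j 1) = 0" if "x \<notin> ?K" for x
  proof -
    have "(\<eta> has_derivative (\<lambda>_. 0)) (at x)"
      by (rule has_derivative_transform_within_open[of "\<lambda>_. 0" _ _ _ "- ?K"])
         (use out[of _] that in \<open>simp_all only: open_Compl closed_closure Compl_iff not_False_eq_True has_derivative_const\<close>)
    then have "partial j \<eta> x = 0"
      using partial_eqI by blast
    then show ?thesis
      using out[OF that] by (simp add: De)
  qed
  have cont_D: "continuous_on UNIV (\<lambda>x. D x (axis j 1))"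
    unfolding De by (intro continuous_intros u_cont conts cont)
  have "(LINT x|M\<^sub>\<Omega>. D x (axis j 1)) = (LINT x|lebesgue. indicator \<Omega> x *\<^sub>R D x (axis j 1))"
    by (rule integral_restrict_space) auto
  also have "\<dots> = (LINT x|lebesgue. D x (axis j 1))"
    using zero K(2) by (intro Bochner_Integration.integral_cong) (auto simp: indicator_def)
  also have "\<dots> = (LINT x|lborel. D x (axis j 1))"
    using borel_measurable_continuous_onI[OF cont_D] by (intro integral_completion) simp
  also have "\<dots> = 0"
  proof (rule integral_partial_compact_support[OF D cont_D K(1)])
    show "u x * \<eta> x = 0" if "x \<notin> ?K" for x
      unfolding out[OF that] by (rule mult_zero_right)
  qed
  finally have "(LINT x|M\<^sub>\<Omega>. u x * partial j \<eta> x + partial j u x * \<eta> x) = 0"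
    by (simp add: De)
  then show "(LINT x|M\<^sub>\<Omega>. u x * partial j \<eta> x) = - (LINT x|M\<^sub>\<Omega>. partial j u x * \<eta> x)"
    using L2_mult_integrable[OF L2_continuous[OF u_cont] test_function_partial_L2[OF \<eta>]]
      L2_mult_integrable[OF L test_function_L2[OF \<eta>]]
    by (simp add: add_eq_0_iff)
qed

lemma is_weak_partial_tensor:
  assumes "\<And>j t. (g j has_real_derivative g' j t) (at t)" and "\<And>j. continuous_on UNIV (g' j)"
  shows "is_weak_partial i (tensor g) (tensor (g(i := g' i)))"
proof -
  have "continuous_on UNIV (g j)" for j
    using assms(1) by (auto intro: DERIV_isCont continuous_at_imp_continuous_on)
  then have "continuous_on UNIV (tensor (g(i := g' i)))"
    using assms(2) by (intro continuous_tensor) simp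
  then show ?thesis
    using is_weak_partial_classical[of "tensor g" i] tensor_differentiable[of g g', OF assms(1)]
      partial_tensor[of g g' i, OF assms(1)]
    by simp
qed

lemma integral_lborel_prod:
  fixes f :: "'a::euclidean_space \<Rightarrow> real \<Rightarrow> real"
  assumes f: "\<And>b. b \<in> Basis \<Longrightarrow> integrable lborel (f b)"
  shows "(LINT x|lborel. (\<Prod>b\<in>Basis. f b (x \<bullet> b))) = (\<Prod>b\<in>Basis. integral\<^sup>L lborel (f b))"
proof -
  interpret product_sigma_finite "\<lambda>_::'a. lborel :: real measure"
    by standard
  have [measurable]: "f b \<in> borel_measurable borel" if "b \<in> Basis" for b
    using f[OF that] by (auto dest: borel_measurable_integrable)
  have "(LINT x|lborel. (\<Prod>b\<in>Basis. f b (x \<bullet> b)))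
      = (LINT x|(\<Pi>\<^sub>M b\<in>(Basis :: 'a set). lborel). (\<Prod>b\<in>Basis. f b ((\<Sum>c\<in>Basis. x c *\<^sub>R c) \<bullet> b)))"
    by (subst lborel_eq, subst integral_distr) auto
  also have "\<dots> = (LINT x|(\<Pi>\<^sub>M b\<in>(Basis :: 'a set). lborel). (\<Prod>b\<in>Basis. f b (x b)))"
    by (intro Bochner_Integration.integral_cong prod.cong) auto
  also have "\<dots> = (\<Prod>b\<in>Basis. integral\<^sup>L lborel (f b))"
    by (intro product_integral_prod f) auto
  finally show ?thesis .
qed

text \<open>Fubini's theorem for products. Lebesgue measure on a Euclidean space is a product
  measure indexed by basis vectors, and \<open>idx\<close> translates these back to coordinates.\<close>

lemma integral_tensor:
  fixes g :: "'n::finite \<Rightarrow> real \<Rightarrow> real"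
  assumes cont: "\<And>j. continuous_on UNIV (g j)"
    and int: "\<And>j. (g j has_integral I j) {0..1}"
  shows "(LINT x|M\<^sub>\<Omega>. tensor g x) = of_real (\<Prod>j\<in>UNIV. I j)"
proof -
  let ?f = "\<lambda>j t. indicator {0<..<1} t * g j t"
  have f_int: "integrable lborel (?f j)" and f_val: "integral\<^sup>L lborel (?f j) = I j" for j
  proof -
    have c: "integrable lborel (\<lambda>t. indicator {0..1} t *\<^sub>R g j t)"
      by (intro borel_integrable_compact continuous_on_subset[OF cont]) auto
    have m: "g j \<in> borel_measurable borel"
      using cont by (rule borel_measurable_continuous_onI)
    have ae: "AE t in lborel. indicator {0..1} t *\<^sub>R g j t = ?f j t"
      using AE_lborel_singleton[of 0] AE_lborel_singleton[of 1]
      by eventually_elim (auto simp: indicator_def)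
    show "integrable lborel (?f j)"
      using c ae m by (subst integrable_cong_AE[symmetric]) auto
    have "integral\<^sup>L lborel (?f j) = (LINT t:{0..1}|lborel. g j t)"
      unfolding set_lebesgue_integral_def
    proof (rule integral_cong_AE)
      show "AE t in lborel. ?f j t = indicator {0..1} t *\<^sub>R g j t"
        using ae by eventually_elim (rule sym)
    qed (use m in auto)
    also have "\<dots> = I j"
      using set_borel_integral_eq_integral(2)[of "{0..1}" "g j"] c integral_unique[OF int]
      by (simp add: set_integrable_def)
    finally show "integral\<^sup>L lborel (?f j) = I j" .
  qed
  define idx :: "real ^ 'n \<Rightarrow> 'n" where "idx = inv_into UNIV (\<lambda>j. axis j 1)"
  have inj: "inj (\<lambda>j::'n. axis j (1::real))"
    by (auto simp: inj_def axis_eq_axis)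
  have idx: "idx (axis j 1) = j" for j
    using inv_into_f_f[OF inj] by (simp add: idx_def)
  have Basis: "Basis = range (\<lambda>j::'n. axis j (1::real))"
    by (auto simp: Basis_vec_def)
  have prod_Basis: "(\<Prod>b\<in>Basis. P (idx b) b) = (\<Prod>j\<in>UNIV. P j (axis j 1))" for P :: "'n \<Rightarrow> real ^ 'n \<Rightarrow> real"
    unfolding Basis by (subst prod.reindex[OF inj]) (simp add: idx)
  have meas: "(\<lambda>x :: real ^ 'n. \<Prod>j\<in>UNIV. ?f j (x $ j)) \<in> borel_measurable borel"
  proof (intro borel_measurable_prod)
    fix j
    have "(\<lambda>x :: real ^ 'n. x $ j) \<in> borel_measurable borel"
      by (intro borel_measurable_continuous_onI continuous_intros)
    moreover have "?f j \<in> borel_measurable borel"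
      using borel_measurable_integrable[OF f_int] by simp
    ultimately show "(\<lambda>x :: real ^ 'n. ?f j (x $ j)) \<in> borel_measurable borel"
      by (rule measurable_compose)
  qed
  have "(LINT x|M\<^sub>\<Omega>. tensor g x) = of_real (LINT x|M\<^sub>\<Omega>. (\<Prod>j\<in>UNIV. g j (x $ j)))"
    by (simp add: tensor_def del: of_real_prod)
  also have "(LINT x|M\<^sub>\<Omega>. (\<Prod>j\<in>UNIV. g j (x $ j)))
      = (LINT x|lebesgue. indicator \<Omega> x *\<^sub>R (\<Prod>j\<in>UNIV. g j (x $ j)))"
    by (rule integral_restrict_space) auto
  also have "\<dots> = (LINT x|lebesgue. (\<Prod>j\<in>UNIV. ?f j (x $ j)))"
  proof (rule Bochner_Integration.integral_cong[OF refl])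
    fix x :: "real ^ 'n"
    have "(\<Prod>j\<in>UNIV. indicator {0<..<1} (x $ j)) = (indicator \<Omega> x :: real)"
      by (cases "x \<in> \<Omega>") (auto simp: mem_box_cart indicator_def)
    then show "indicator \<Omega> x *\<^sub>R (\<Prod>j\<in>UNIV. g j (x $ j)) = (\<Prod>j\<in>UNIV. ?f j (x $ j))"
      by (simp add: prod.distrib)
  qed
  also have "\<dots> = (LINT x|lborel. (\<Prod>j\<in>UNIV. ?f j (x $ j)))"
    using meas by (intro integral_completion) simp
  also have "\<dots> = (LINT x|lborel. (\<Prod>b\<in>Basis. ?f (idx b) (x \<bullet> b)))"
    by (subst prod_Basis) (simp add: inner_axis)
  also have "\<dots> = (\<Prod>b\<in>Basis. integral\<^sup>L lborel (?f (idx b)))"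
    by (rule integral_lborel_prod) (rule f_int)
  also have "\<dots> = (\<Prod>j\<in>UNIV. I j)"
    by (subst prod_Basis) (simp add: f_val)
  finally show ?thesis .
qed

section \<open>The energy norm in terms of explicit weak derivatives\<close>

definition L2_sq :: "(real ^ 'n \<Rightarrow> complex) \<Rightarrow> real"
  where "L2_sq u = (LINT x|M\<^sub>\<Omega>. (norm (u x))\<^sup>2)"

lemma L2_sq_nonneg: "0 \<le> L2_sq u"
  by (simp add: L2_sq_def)

lemma L2_sq_cong_AE:
  assumes "AE x in M\<^sub>\<Omega>. u x = v x" "u \<in> L2" "v \<in> L2"
  shows "L2_sq u = L2_sq v"
  unfolding L2_sq_def
proof (rule integral_cong_AE)
  show "AE x in M\<^sub>\<Omega>. (norm (u x))\<^sup>2 = (norm (v x))\<^sup>2"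
    using assms(1) by eventually_elim simp
qed (use assms in \<open>auto dest: L2_measurable\<close>)

lemma L2_sq_eq_0D:
  assumes "u \<in> L2" "L2_sq u = 0"
  shows "AE x in M\<^sub>\<Omega>. u x = 0"
proof -
  have "AE x in M\<^sub>\<Omega>. (norm (u x))\<^sup>2 = 0"
    using assms by (subst integral_nonneg_eq_0_iff_AE[symmetric]) (auto simp: L2_def L2_sq_def)
  then show ?thesis
    by eventually_elim simp
qed

lemma integral_mult_cnj_self: "(LINT x|M\<^sub>\<Omega>. u x * cnj (u x)) = of_real (L2_sq u)"
  by (simp add: L2_sq_def complex_norm_square[symmetric] del: of_real_power)

lemma E_inner_eq:
  fixes u v z w :: "real ^ 'n \<Rightarrow> complex"
  assumes g: "\<And>j. is_weak_partial j u (g j)" and h: "\<And>j. is_weak_partial j v (h j)"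
    and L: "u \<in> L2" "v \<in> L2" "z \<in> L2" "w \<in> L2"
  shows "E_inner \<alpha> (u, z) (v, w) = (\<Sum>j\<in>UNIV. LINT x|M\<^sub>\<Omega>. g j x * cnj (h j x))
    + of_real \<alpha> * (LINT x|M\<^sub>\<Omega>. u x * cnj (v x)) + (LINT x|M\<^sub>\<Omega>. z x * cnj (w x))"
proof -
  have Lg: "g j \<in> L2" "h j \<in> L2" "weak_partial j u \<in> L2" "weak_partial j v \<in> L2" for j
    using g h weak_partial_eqI(1)[OF g] weak_partial_eqI(1)[OF h] by (auto simp: is_weak_partial_def)
  have int: "integrable M\<^sub>\<Omega> (\<lambda>x. p x * cnj (q x))" if "p \<in> L2" "q \<in> L2" for p q :: "real ^ 'n \<Rightarrow> complex"
    using L2_mult_integrable[OF that(1) L2_cnj[OF that(2)]] .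
  have "(LINT x|M\<^sub>\<Omega>. (\<Sum>j\<in>UNIV. weak_partial j u x * cnj (weak_partial j v x)) + of_real \<alpha> * (u x * cnj (v x)))
      = (\<Sum>j\<in>UNIV. LINT x|M\<^sub>\<Omega>. weak_partial j u x * cnj (weak_partial j v x))
        + of_real \<alpha> * (LINT x|M\<^sub>\<Omega>. u x * cnj (v x))"
    using int L Lg by (subst Bochner_Integration.integral_add) (auto intro!: Bochner_Integration.integral_sum)
  moreover have "(LINT x|M\<^sub>\<Omega>. weak_partial j u x * cnj (weak_partial j v x)) = (LINT x|M\<^sub>\<Omega>. g j x * cnj (h j x))" for j
  proof (rule integral_cong_AE)
    show "AE x in M\<^sub>\<Omega>. weak_partial j u x * cnj (weak_partial j v x) = g j x * cnj (h j x)"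
      using weak_partial_eqI(2)[OF g[of j]] weak_partial_eqI(2)[OF h[of j]] by eventually_elim simp
  qed (auto intro!: borel_measurable_integrable int Lg)
  ultimately show ?thesis
    by (simp add: E_inner_def)
qed

lemma E_norm_eq:
  fixes u z :: "real ^ 'n \<Rightarrow> complex"
  assumes "\<And>j. is_weak_partial j u (g j)" and "u \<in> L2" "z \<in> L2"
  shows "E_norm \<alpha> (u, z) = sqrt ((\<Sum>j\<in>UNIV. L2_sq (g j)) + \<alpha> * L2_sq u + L2_sq z)"
  using assms by (simp add: E_norm_def E_inner_eq[OF assms(1) assms(1)] integral_mult_cnj_self
      flip: of_real_sum of_real_mult of_real_add)

lemma H1_norm_eq:
  fixes u :: "real ^ 'n \<Rightarrow> complex"
  assumes g: "\<And>j. is_weak_partial j u (g j)" and "u \<in> L2"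
  shows "H1_norm u = sqrt (L2_sq u + (\<Sum>j\<in>UNIV. L2_sq (g j)))"
proof -
  have wp: "weak_partial j u \<in> L2" and gL: "g j \<in> L2" for j
    using g[of j] weak_partial_eqI(1)[OF g, of j] by (auto simp: is_weak_partial_def)
  have "(LINT x|M\<^sub>\<Omega>. (norm (u x))\<^sup>2 + (\<Sum>j\<in>UNIV. (norm (weak_partial j u x))\<^sup>2))
      = L2_sq u + (\<Sum>j\<in>UNIV. L2_sq (weak_partial j u))"
    using wp assms(2) by (simp add: L2_sq_def L2_def)
  moreover have "L2_sq (weak_partial j u) = L2_sq (g j)" for j
    using weak_partial_eqI(2)[OF g] wp gL by (rule L2_sq_cong_AE)
  ultimately show ?thesis
    by (simp add: H1_norm_def)
qed

lemma is_weak_partial_scale: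
  "is_weak_partial j u g \<Longrightarrow> u \<in> L2 \<Longrightarrow> is_weak_partial j (\<lambda>x. c * u x) (\<lambda>x. c * g x)"
  using is_weak_partial_linear[of j u g u g c 0] by simp

lemma is_weak_partial_diff:
  "is_weak_partial j u g \<Longrightarrow> is_weak_partial j v h \<Longrightarrow> u \<in> L2 \<Longrightarrow> v \<in> L2 \<Longrightarrow>
    is_weak_partial j (\<lambda>x. u x - v x) (\<lambda>x. g x - h x)"
  using is_weak_partial_linear[of j u g v h 1 "-1"] by simp

text \<open>Values of \<open>spectral_op\<close> are determined only up to elements of energy norm \<open>0\<close>, and this lemma
  shows that distances do not depend on the representatives. An element of energy norm \<open>0\<close> has
  vanishing weak gradient and vanishing second component. Its first component is controlled directly
  only through the term with the factor \<open>\<alpha>\<close>, and this is exactly how it enters the energy norm of the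
  difference; hence the alternative \<open>\<alpha> = 0\<close> in the proof.\<close>

lemma E_norm_diff_of_multiples:
  fixes u1 u2 v z1 z2 w :: "real ^ 'n \<Rightarrow> complex"
  assumes H: "u1 \<in> H1" "u2 \<in> H1" "v \<in> H1" and Z: "z1 \<in> L2" "z2 \<in> L2" "w \<in> L2" and \<alpha>: "\<alpha> \<ge> 0"
    and 1: "E_norm \<alpha> ((u1, z1) - E_scale a (v, w)) = 0"
    and 2: "E_norm \<alpha> ((u2, z2) - E_scale b (v, w)) = 0"
  shows "E_norm \<alpha> ((u1, z1) - (u2, z2)) = norm (a - b) * E_norm \<alpha> (v, w)"
proof -
  have L: "u1 \<in> L2" "u2 \<in> L2" "v \<in> L2"
    using H by (auto simp: H1_def)
  obtain p where p: "\<And>j. is_weak_partial j u1 (p j)"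
    using H(1) unfolding H1_def by (auto dest!: choice)
  obtain q where q: "\<And>j. is_weak_partial j u2 (q j)"
    using H(2) unfolding H1_def by (auto dest!: choice)
  obtain r where r: "\<And>j. is_weak_partial j v (r j)"
    using H(3) unfolding H1_def by (auto dest!: choice)
  have Lp: "p j \<in> L2" "q j \<in> L2" "r j \<in> L2" for j
    using p q r by (auto simp: is_weak_partial_def)
  have zero: "(\<forall>j. AE x in M\<^sub>\<Omega>. p j x = a * r j x) \<and> (AE x in M\<^sub>\<Omega>. z1 x = a * w x)
      \<and> (\<alpha> = 0 \<or> (AE x in M\<^sub>\<Omega>. u1 x = a * v x))"
    if 1: "E_norm \<alpha> ((u1, z1) - E_scale a (v, w)) = 0" and p: "\<And>j. is_weak_partial j u1 (p j)"
      and Lu: "u1 \<in> L2" "z1 \<in> L2"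
    for u1 z1 p a
  proof -
    have Lp: "p j \<in> L2" for j
      using p by (auto simp: is_weak_partial_def)
    have "0 = E_norm \<alpha> (\<lambda>x. u1 x - a * v x, \<lambda>x. z1 x - a * w x)"
      using 1 by (simp add: E_scale_def minus_prod_def fun_diff_def)
    also have "\<dots> = sqrt ((\<Sum>j\<in>UNIV. L2_sq (\<lambda>x. p j x - a * r j x)) + \<alpha> * L2_sq (\<lambda>x. u1 x - a * v x)
        + L2_sq (\<lambda>x. z1 x - a * w x))"
      by (intro E_norm_eq is_weak_partial_diff is_weak_partial_scale p r L2_diff L2_scale L Lu Z)
    finally have "(\<Sum>j\<in>UNIV. L2_sq (\<lambda>x. p j x - a * r j x)) + \<alpha> * L2_sq (\<lambda>x. u1 x - a * v x)
        + L2_sq (\<lambda>x. z1 x - a * w x) = 0"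
      by simp
    moreover have "0 \<le> (\<Sum>j\<in>UNIV. L2_sq (\<lambda>x. p j x - a * r j x))"
      by (intro sum_nonneg L2_sq_nonneg)
    moreover have "0 \<le> \<alpha> * L2_sq (\<lambda>x. u1 x - a * v x)"
      using \<alpha> by (intro mult_nonneg_nonneg L2_sq_nonneg)
    ultimately have "(\<Sum>j\<in>UNIV. L2_sq (\<lambda>x. p j x - a * r j x)) = 0"
        "\<alpha> * L2_sq (\<lambda>x. u1 x - a * v x) = 0" "L2_sq (\<lambda>x. z1 x - a * w x) = 0"
      using L2_sq_nonneg[of "\<lambda>x. z1 x - a * w x"] by linarith+
    then have "\<And>j. L2_sq (\<lambda>x. p j x - a * r j x) = 0" "L2_sq (\<lambda>x. z1 x - a * w x) = 0"
        "\<alpha> = 0 \<or> L2_sq (\<lambda>x. u1 x - a * v x) = 0"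
      by (auto simp: sum_nonneg_eq_0_iff L2_sq_nonneg)
    moreover have "(\<lambda>x. p j x - a * r j x) \<in> L2" "(\<lambda>x. z1 x - a * w x) \<in> L2" "(\<lambda>x. u1 x - a * v x) \<in> L2" for j
      by (intro L2_diff L2_scale L Lu Z Lp \<open>\<And>j. r j \<in> L2\<close>)+
    ultimately have "\<And>j. AE x in M\<^sub>\<Omega>. p j x - a * r j x = 0" "AE x in M\<^sub>\<Omega>. z1 x - a * w x = 0"
        "\<alpha> = 0 \<or> (AE x in M\<^sub>\<Omega>. u1 x - a * v x = 0)"
      using L2_sq_eq_0D by blast+
    then show ?thesis
      by simp
  qed
  have P: "\<And>j. AE x in M\<^sub>\<Omega>. p j x = a * r j x" "AE x in M\<^sub>\<Omega>. z1 x = a * w x"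
      "\<alpha> = 0 \<or> (AE x in M\<^sub>\<Omega>. u1 x = a * v x)"
    using zero[OF 1 p L(1) Z(1)] by auto
  have Q: "\<And>j. AE x in M\<^sub>\<Omega>. q j x = b * r j x" "AE x in M\<^sub>\<Omega>. z2 x = b * w x"
      "\<alpha> = 0 \<or> (AE x in M\<^sub>\<Omega>. u2 x = b * v x)"
    using zero[OF 2 q L(2) Z(2)] by auto
  have sq: "L2_sq (\<lambda>x. f x - g x) = (norm (a - b))\<^sup>2 * L2_sq h"
    if "AE x in M\<^sub>\<Omega>. f x = a * h x" "AE x in M\<^sub>\<Omega>. g x = b * h x" "f \<in> L2" "g \<in> L2" "h \<in> L2"
    for f g h :: "real ^ 'n \<Rightarrow> complex"
  proof -
    have "L2_sq (\<lambda>x. f x - g x) = L2_sq (\<lambda>x. (a - b) * h x)"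
    proof (rule L2_sq_cong_AE)
      show "AE x in M\<^sub>\<Omega>. f x - g x = (a - b) * h x"
        using that(1,2) by eventually_elim (simp add: algebra_simps)
    qed (intro L2_diff L2_scale that)+
    then show ?thesis
      by (simp add: L2_sq_def norm_mult power_mult_distrib)
  qed
  have "E_norm \<alpha> ((u1, z1) - (u2, z2)) = E_norm \<alpha> (\<lambda>x. u1 x - u2 x, \<lambda>x. z1 x - z2 x)"
    by (simp add: minus_prod_def fun_diff_def)
  also have "\<dots> = sqrt ((\<Sum>j\<in>UNIV. L2_sq (\<lambda>x. p j x - q j x)) + \<alpha> * L2_sq (\<lambda>x. u1 x - u2 x)
        + L2_sq (\<lambda>x. z1 x - z2 x))"
    by (intro E_norm_eq is_weak_partial_diff p q L2_diff L Z)
  also have "(\<Sum>j\<in>UNIV. L2_sq (\<lambda>x. p j x - q j x)) = (norm (a - b))\<^sup>2 * (\<Sum>j\<in>UNIV. L2_sq (r j))"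
    by (simp add: sq[OF P(1) Q(1) Lp] sum_distrib_left)
  also have "\<alpha> * L2_sq (\<lambda>x. u1 x - u2 x) = (norm (a - b))\<^sup>2 * (\<alpha> * L2_sq v)"
    using P(3) Q(3) sq[of u1 v u2] L by auto
  also have "L2_sq (\<lambda>x. z1 x - z2 x) = (norm (a - b))\<^sup>2 * L2_sq w"
    by (rule sq[OF P(2) Q(2) Z])
  also have "sqrt ((norm (a - b))\<^sup>2 * (\<Sum>j\<in>UNIV. L2_sq (r j)) + (norm (a - b))\<^sup>2 * (\<alpha> * L2_sq v)
        + (norm (a - b))\<^sup>2 * L2_sq w)
      = norm (a - b) * sqrt ((\<Sum>j\<in>UNIV. L2_sq (r j)) + \<alpha> * L2_sq v + L2_sq w)"
    by (simp add: real_sqrt_mult flip: distrib_left)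
  also have "sqrt ((\<Sum>j\<in>UNIV. L2_sq (r j)) + \<alpha> * L2_sq v + L2_sq w) = E_norm \<alpha> (v, w)"
    by (rule E_norm_eq[symmetric]) (intro r L Z)+
  finally show ?thesis .
qed

section \<open>Orthonormality of the eigenvectors\<close>

definition sine :: "nat \<Rightarrow> real \<Rightarrow> real"
  where "sine a t = sqrt 2 * sin (real a * pi * t)"

definition sine_deriv :: "nat \<Rightarrow> real \<Rightarrow> real"
  where "sine_deriv a t = sqrt 2 * (real a * pi) * cos (real a * pi * t)"

lemma sine_has_derivative: "(sine a has_real_derivative sine_deriv a t) (at t)"
  unfolding sine_def[abs_def] sine_deriv_def by (auto intro!: derivative_eq_intros)

lemma continuous_sine: "continuous_on A (sine a)" "continuous_on A (sine_deriv a)"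
  unfolding sine_def[abs_def] sine_deriv_def[abs_def] by (intro continuous_intros)+

lemma smooth_upto_sine: "smooth_upto m (sine a)"
proof -
  have "smooth_upto m (\<lambda>t. sin (real a * pi * t + 0))"
    by (rule smooth_upto_affine) (simp add: smooth_upto_sin_cos)
  then show ?thesis
    unfolding sine_def[abs_def] by (intro smooth_upto_mult smooth_upto_const) simp
qed

text \<open>The normalisation \<open>2 powr (N / 2)\<close> is distributed over the factors, one \<open>sqrt 2\<close> for each
  coordinate, so that every factor has norm \<open>1\<close> in \<open>L\<^sup>2(0, 1)\<close>.\<close>

lemma e_fun_tensor: "e_fun \<kappa> = tensor (\<lambda>j. sine (\<kappa> $ j))"
proof
  fix x :: "real ^ 'a"
  have "2 powr (real CARD('a) / 2) = (2 powr (1 / 2)) powr real CARD('a)"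
    by (subst powr_powr) simp
  also have "\<dots> = sqrt 2 ^ CARD('a)"
    by (simp add: powr_half_sqrt powr_realpow)
  finally show "e_fun \<kappa> x = tensor (\<lambda>j. sine (\<kappa> $ j)) x"
    by (simp add: e_fun_def tensor_def sine_def prod.distrib)
qed

lemma continuous_e_fun: "continuous_on UNIV (e_fun \<kappa>)"
  unfolding e_fun_tensor by (intro continuous_tensor continuous_sine)

lemma e_fun_L2: "e_fun \<kappa> \<in> L2"
  by (intro L2_continuous continuous_e_fun)

definition e_partial :: "'n::finite \<Rightarrow> nat ^ 'n \<Rightarrow> real ^ 'n \<Rightarrow> complex"
  where "e_partial i \<kappa> = tensor ((\<lambda>j. sine (\<kappa> $ j))(i := sine_deriv (\<kappa> $ i)))"

lemma is_weak_partial_e_fun: "is_weak_partial i (e_fun \<kappa>) (e_partial i \<kappa>)"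
  unfolding e_fun_tensor e_partial_def
  by (rule is_weak_partial_tensor[where g'="\<lambda>j. sine_deriv (\<kappa> $ j)"])
     (rule sine_has_derivative, rule continuous_sine)

lemma has_integral_cos_pi: "((\<lambda>t. cos (of_int k * pi * t)) has_integral (if k = 0 then 1 else 0)) {0..1}"
proof (cases "k = 0")
  case True
  then show ?thesis
    using has_integral_const_real[of "1::real" 0 1] by simp
next
  case False
  have "((\<lambda>t. cos (of_int k * pi * t)) has_integral
      sin (of_int k * pi * 1) / (of_int k * pi) - sin (of_int k * pi * 0) / (of_int k * pi)) {0..1}"
    by (rule fundamental_theorem_of_calculus)
       (use False in \<open>auto intro!: derivative_eq_intros simp flip: has_real_derivative_iff_has_vector_derivative\<close>)
  moreover have "sin (of_int k * pi) = 0"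
    using sin_zero_iff_int2 by blast
  ultimately show ?thesis
    using False by simp
qed

lemma has_integral_sine_sine:
  assumes "a \<ge> 1" "b \<ge> 1"
  shows "((\<lambda>t. sine a t * sine b t) has_integral (if a = b then 1 else 0)) {0..1}"
proof -
  have "((\<lambda>t. cos (of_int (int a - int b) * pi * t) - cos (of_int (int a + int b) * pi * t))
      has_integral (if int a - int b = 0 then 1 else 0) - (if int a + int b = 0 then 1 else 0)) {0..1}"
    by (intro has_integral_diff has_integral_cos_pi)
  also have "(\<lambda>t. cos (of_int (int a - int b) * pi * t) - cos (of_int (int a + int b) * pi * t))
      = (\<lambda>t. sine a t * sine b t)"
    by (auto simp: sine_def cos_add cos_diff algebra_simps)
  finally show ?thesis
    using assms by (auto split: if_splits)
qed

lemma has_integral_sine_deriv: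
  assumes "a \<ge> 1" "b \<ge> 1"
  shows "((\<lambda>t. sine_deriv a t * sine_deriv b t) has_integral (if a = b then (real a * pi)\<^sup>2 else 0)) {0..1}"
proof -
  have "((\<lambda>t. (real a * pi * (real b * pi)) *
        (cos (of_int (int a - int b) * pi * t) + cos (of_int (int a + int b) * pi * t)))
      has_integral (real a * pi * (real b * pi)) *
        ((if int a - int b = 0 then 1 else 0) + (if int a + int b = 0 then 1 else 0))) {0..1}"
    by (intro has_integral_mult_right has_integral_add has_integral_cos_pi)
  also have "(\<lambda>t. (real a * pi * (real b * pi)) *
        (cos (of_int (int a - int b) * pi * t) + cos (of_int (int a + int b) * pi * t)))
      = (\<lambda>t. sine_deriv a t * sine_deriv b t)"
    by (auto simp: sine_deriv_def cos_add cos_diff algebra_simps)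
  finally show ?thesis
    using assms by (auto split: if_splits simp: power2_eq_square)
qed

lemma tensor_mult_cnj: "tensor f x * cnj (tensor g x) = tensor (\<lambda>j t. f j t * g j t) x"
  by (simp add: tensor_def prod.distrib)

lemma prod_Kronecker:
  fixes \<kappa> \<mu> :: "nat ^ 'n"
  shows "(\<Prod>j\<in>UNIV. if \<kappa> $ j = \<mu> $ j then c j else 0) = (if \<kappa> = \<mu> then \<Prod>j\<in>UNIV. c j else (0::real))"
proof (cases "\<kappa> = \<mu>")
  case False
  then obtain j where "\<kappa> $ j \<noteq> \<mu> $ j"
    by (auto simp: vec_eq_iff)
  then have "(\<Prod>j\<in>UNIV. if \<kappa> $ j = \<mu> $ j then c j else 0) = 0"
    by (intro prod_zero) auto
  with False show ?thesis
    by simp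
qed simp

lemma integral_e_fun:
  fixes \<kappa> \<mu> :: "('n::finite) multi_index"
  assumes "\<kappa> \<in> multi_indices" "\<mu> \<in> multi_indices"
  shows "(LINT x|M\<^sub>\<Omega>. e_fun \<kappa> x * cnj (e_fun \<mu> x)) = (if \<kappa> = \<mu> then 1 else 0)"
proof -
  have "(LINT x|M\<^sub>\<Omega>. e_fun \<kappa> x * cnj (e_fun \<mu> x))
      = of_real (\<Prod>j\<in>UNIV. if \<kappa> $ j = \<mu> $ j then 1 else 0)"
    unfolding e_fun_tensor tensor_mult_cnj using assms
    by (intro integral_tensor has_integral_sine_sine continuous_intros continuous_sine)
       (auto simp: multi_indices_def)
  then show ?thesis
    by (subst (asm) prod_Kronecker) simp
qed

lemma integral_e_partial:
  fixes \<kappa> \<mu> :: "('n::finite) multi_index"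
  assumes "\<kappa> \<in> multi_indices" "\<mu> \<in> multi_indices"
  shows "(LINT x|M\<^sub>\<Omega>. e_partial i \<kappa> x * cnj (e_partial i \<mu> x))
    = (if \<kappa> = \<mu> then of_real ((real (\<kappa> $ i) * pi)\<^sup>2) else 0)"
proof -
  let ?s = "\<lambda>\<kappa>. (\<lambda>j. sine (\<kappa> $ j))(i := sine_deriv (\<kappa> $ i))"
  let ?c = "\<lambda>j. if j = i then (real (\<kappa> $ i) * pi)\<^sup>2 else 1"
  have "(LINT x|M\<^sub>\<Omega>. e_partial i \<kappa> x * cnj (e_partial i \<mu> x))
      = of_real (\<Prod>j\<in>UNIV. if \<kappa> $ j = \<mu> $ j then ?c j else 0)"
    unfolding e_partial_def tensor_mult_cnj
  proof (rule integral_tensor)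
    fix j
    show "continuous_on UNIV (\<lambda>t. ?s \<kappa> j t * ?s \<mu> j t)"
      by (cases "j = i") (auto intro!: continuous_intros continuous_sine)
    show "((\<lambda>t. ?s \<kappa> j t * ?s \<mu> j t) has_integral (if \<kappa> $ j = \<mu> $ j then ?c j else 0)) {0..1}"
      using assms has_integral_sine_sine[of "\<kappa> $ j" "\<mu> $ j"] has_integral_sine_deriv[of "\<kappa> $ j" "\<mu> $ j"]
      by (cases "j = i") (auto simp: multi_indices_def)
  qed
  also have "(\<Prod>j\<in>UNIV. if \<kappa> $ j = \<mu> $ j then ?c j else 0) = (if \<kappa> = \<mu> then (real (\<kappa> $ i) * pi)\<^sup>2 else 0)"
    by (subst prod_Kronecker) (simp add: prod.delta)
  finally show ?thesis
    by simp
qed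

text \<open>The gradient contributes \<open>pi\<^sup>2 |\<kappa>|\<^sup>2\<close> because the sine and cosine products are orthogonal in each
  coordinate separately. Both components of an eigenvector are multiples of the same \<open>e_fun \<kappa>\<close>, so
  one formula with free coefficients serves all pairs of branches.\<close>

lemma E_inner_modes:
  fixes \<kappa> \<mu> :: "('n::finite) multi_index"
  assumes "\<kappa> \<in> multi_indices" "\<mu> \<in> multi_indices"
  shows "E_inner \<alpha> (\<lambda>x. a * e_fun \<kappa> x, \<lambda>x. b * e_fun \<kappa> x) (\<lambda>x. c * e_fun \<mu> x, \<lambda>x. d * e_fun \<mu> x)
    = (if \<kappa> = \<mu> then a * cnj c * of_real (pi\<^sup>2 * real (sq_sum \<kappa>) + \<alpha>) + b * cnj d else 0)"
proof -
  have pull: "(LINT x|M\<^sub>\<Omega>. (p * f x) * cnj (q * g x)) = p * cnj q * (LINT x|M\<^sub>\<Omega>. f x * cnj (g x))"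
    for p q and f g :: "real ^ 'n \<Rightarrow> complex"
  proof -
    have "(\<lambda>x. (p * f x) * cnj (q * g x)) = (\<lambda>x. (p * cnj q) * (f x * cnj (g x)))"
      by (auto simp: mult_ac)
    then show ?thesis
      by simp
  qed
  have "E_inner \<alpha> (\<lambda>x. a * e_fun \<kappa> x, \<lambda>x. b * e_fun \<kappa> x) (\<lambda>x. c * e_fun \<mu> x, \<lambda>x. d * e_fun \<mu> x)
      = (\<Sum>i\<in>UNIV. LINT x|M\<^sub>\<Omega>. (a * e_partial i \<kappa> x) * cnj (c * e_partial i \<mu> x))
        + of_real \<alpha> * (LINT x|M\<^sub>\<Omega>. (a * e_fun \<kappa> x) * cnj (c * e_fun \<mu> x))
        + (LINT x|M\<^sub>\<Omega>. (b * e_fun \<kappa> x) * cnj (d * e_fun \<mu> x))"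
    by (intro E_inner_eq is_weak_partial_scale is_weak_partial_e_fun L2_scale e_fun_L2)
  also have "\<dots> = (if \<kappa> = \<mu> then a * cnj c * of_real (\<Sum>i\<in>UNIV. (real (\<kappa> $ i) * pi)\<^sup>2)
        + of_real \<alpha> * (a * cnj c) + b * cnj d else 0)"
    unfolding pull using assms by (simp add: integral_e_fun integral_e_partial sum_distrib_left)
  also have "(\<Sum>i\<in>UNIV. (real (\<kappa> $ i) * pi)\<^sup>2) = pi\<^sup>2 * real (sq_sum \<kappa>)"
    by (simp add: sq_sum_def power_mult_distrib sum_distrib_left mult.commute)
  finally show ?thesis
    by (simp add: algebra_simps)
qed

lemma branch_eigenvector_eq:
  "branch_eigenvector \<alpha> \<kappa> s =
    (\<lambda>x. 1 / (of_real (sqrt 2) * branch_eigenvalue \<alpha> \<kappa> s) * e_fun \<kappa> x, \<lambda>x. - (1 / of_real (sqrt 2)) * e_fun \<kappa> x)"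
  by (simp add: branch_eigenvector_def E_scale_def)

lemma sq_sum_pos:
  fixes \<kappa> :: "('n::finite) multi_index"
  assumes "\<kappa> \<in> multi_indices"
  shows "sq_sum \<kappa> \<ge> 1"
proof -
  have "1 \<le> (\<kappa> $ undefined)\<^sup>2"
    using assms by (auto simp: multi_indices_def)
  also have "\<dots> \<le> sq_sum \<kappa>"
    unfolding sq_sum_def by (rule member_le_sum) auto
  finally show ?thesis .
qed

text \<open>For \<open>\<kappa> = \<mu>\<close> the energy part equals \<open>s * r / 2\<close> and the \<open>L\<^sup>2\<close> part \<open>1 / 2\<close>; they add up to \<open>1\<close> on the same
  branch and cancel on opposite branches.\<close>

lemma E_inner_eigenvectors:
  assumes "\<alpha> \<ge> 0" and \<kappa>: "\<kappa> \<in> multi_indices" "\<mu> \<in> multi_indices" and s: "s \<in> {1, -1}" "r \<in> {1, -1}"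
  shows "E_inner \<alpha> (branch_eigenvector \<alpha> \<kappa> s) (branch_eigenvector \<alpha> \<mu> r)
    = (if \<kappa> = \<mu> \<and> s = r then 1 else 0)"
proof -
  define w where "w = sqrt (pi\<^sup>2 * real (sq_sum \<kappa>) + \<alpha>)"
  have "pi\<^sup>2 * real (sq_sum \<kappa>) + \<alpha> > 0"
    using sq_sum_pos[OF \<kappa>(1)] assms(1) by (intro add_pos_nonneg mult_pos_pos) auto
  then have w: "w > 0" "pi\<^sup>2 * real (sq_sum \<kappa>) + \<alpha> = w\<^sup>2"
    by (auto simp: w_def)
  have ev: "branch_eigenvalue \<alpha> \<kappa> t = of_real (t * w) * \<i>" for t
    by (simp add: branch_eigenvalue_def w_def)
  have "1 / (of_real (sqrt 2) * branch_eigenvalue \<alpha> \<kappa> s) * cnj (1 / (of_real (sqrt 2) * branch_eigenvalue \<alpha> \<kappa> r))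
      * of_real (w\<^sup>2) + - (1 / of_real (sqrt 2)) * cnj (- (1 / of_real (sqrt 2)))
      = (if s = r then 1 else 0)"
    unfolding ev using s w(1) by (auto simp: complex_eq_iff power2_eq_square field_simps)
  then show ?thesis
    unfolding branch_eigenvector_eq E_inner_modes[OF \<kappa>] w(2) by auto
qed

section \<open>The eigenfunctions belong to the energy space\<close>

lemma abs_sine_le:
  assumes "0 \<le> t"
  shows "\<bar>sine a t\<bar> \<le> sqrt 2 * (real a * pi) * t"
  using abs_sin_x_le_abs_x[of "real a * pi * t"] assms by (simp add: sine_def abs_mult)

text \<open>The reflection exchanges the two endpoints, so that linear vanishing at \<open>0\<close> also gives linear
  vanishing at \<open>1\<close>.\<close>

lemma sine_reflect: "\<bar>sine a (1 - t)\<bar> = \<bar>sine a t\<bar>"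
proof -
  have "sin (real a * pi * (1 - t)) = sin (real a * pi) * cos (real a * pi * t) - cos (real a * pi) * sin (real a * pi * t)"
    by (simp add: sin_diff right_diff_distrib)
  then show ?thesis
    by (simp add: sine_def abs_mult cos_npi sin_npi power_abs)
qed

definition cut_sine :: "nat \<Rightarrow> nat \<Rightarrow> real \<Rightarrow> real"
  where "cut_sine a m t = cutoff m t * cutoff m (1 - t) * sine a t"

definition cut_sine_deriv :: "nat \<Rightarrow> nat \<Rightarrow> real \<Rightarrow> real"
  where "cut_sine_deriv a m t = cutoff_deriv m t * cutoff m (1 - t) * sine a t
    - cutoff m t * cutoff_deriv m (1 - t) * sine a t + cutoff m t * cutoff m (1 - t) * sine_deriv a t"

lemma cut_sine_has_derivative: "(cut_sine a m has_real_derivative cut_sine_deriv a m t) (at t)"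
proof -
  have "((\<lambda>t. cutoff m (1 - t)) has_real_derivative cutoff_deriv m (1 - t) * (- 1)) (at t)"
    by (rule DERIV_chain'[of "\<lambda>t. 1 - t" _ t UNIV "cutoff m"])
       (auto intro!: derivative_eq_intros cutoff_has_derivative)
  then show ?thesis
    unfolding cut_sine_def[abs_def] cut_sine_deriv_def
    by (auto intro!: derivative_eq_intros cutoff_has_derivative sine_has_derivative simp: algebra_simps)
qed

lemma smooth_upto_cut_sine: "smooth_upto k (cut_sine a m)"
  unfolding cut_sine_def[abs_def]
  using smooth_upto_affine[OF smooth_upto_cutoff, of k m "-1" 1]
  by (intro smooth_upto_mult smooth_upto_cutoff smooth_upto_sine) simp

lemma continuous_cut_sine: "continuous_on UNIV (cut_sine a m)" "continuous_on UNIV (cut_sine_deriv a m)"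
proof -
  obtain g where g: "\<And>t. (cut_sine a m has_real_derivative g t) (at t)" "smooth_upto (Suc 0) g"
    using smooth_upto_cut_sine[of "Suc (Suc 0)" a m] by auto
  then have "g = cut_sine_deriv a m"
    using cut_sine_has_derivative by (intro ext) (meson DERIV_unique)
  with g show "continuous_on UNIV (cut_sine a m)" "continuous_on UNIV (cut_sine_deriv a m)"
    by (auto intro!: continuous_at_imp_continuous_on intro: DERIV_isCont)
qed

text \<open>In the derivative, each of the two terms in which a cutoff is differentiated is bounded by \<open>2 K\<close>
  with \<open>K = sqrt 2 * a * pi\<close>, since the sine vanishes linearly at the endpoint in question; the
  remaining term is bounded by \<open>K\<close>.\<close>

lemma cut_sine_bounds:
  assumes "0 < t" "t < 1"
  shows "\<bar>cut_sine a m t\<bar> \<le> sqrt 2" and "\<bar>cut_sine_deriv a m t\<bar> \<le> 5 * (sqrt 2 * (real a * pi))"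
proof -
  have c: "\<bar>cutoff m s\<bar> \<le> 1" for s
    using cutoff_bounds by (simp add: abs_of_nonneg)
  have "\<bar>cutoff m t * cutoff m (1 - t)\<bar> * \<bar>sine a t\<bar> \<le> 1 * sqrt 2"
    using c by (intro mult_mono) (auto simp: abs_mult sine_def intro!: mult_le_one)
  then show "\<bar>cut_sine a m t\<bar> \<le> sqrt 2"
    by (simp add: cut_sine_def abs_mult)
  let ?K = "sqrt 2 * (real a * pi)"
  have half: "\<bar>cutoff_deriv m s * sine a s\<bar> \<le> 2 * ?K" if "0 < s" for s
  proof -
    have "\<bar>cutoff_deriv m s * sine a s\<bar> \<le> \<bar>cutoff_deriv m s\<bar> * (?K * s)"
      unfolding abs_mult using abs_sine_le[of s a] that by (intro mult_left_mono) auto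
    also have "\<dots> = (\<bar>cutoff_deriv m s\<bar> * s) * ?K"
      by simp
    also have "\<dots> \<le> 2 * ?K"
      using cutoff_deriv_bound[of s m] that by (intro mult_right_mono) auto
    finally show ?thesis .
  qed
  have 1: "\<bar>cutoff_deriv m t * cutoff m (1 - t) * sine a t\<bar> \<le> (2 * ?K) * 1"
    using mult_mono[OF half[OF assms(1)] c[of "1 - t"]] by (simp add: abs_mult mult_ac)
  have "\<bar>cutoff_deriv m (1 - t) * sine a t\<bar> \<le> 2 * ?K"
    using half[of "1 - t"] assms by (simp add: abs_mult sine_reflect)
  from mult_mono[OF this c[of t]]
  have 2: "\<bar>cutoff m t * cutoff_deriv m (1 - t) * sine a t\<bar> \<le> (2 * ?K) * 1"
    by (simp add: abs_mult mult_ac)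
  have "\<bar>cutoff m t * cutoff m (1 - t)\<bar> * \<bar>sine_deriv a t\<bar> \<le> 1 * ?K"
    using c by (intro mult_mono) (auto simp: abs_mult sine_deriv_def mult_left_le intro!: mult_le_one)
  then have 3: "\<bar>cutoff m t * cutoff m (1 - t) * sine_deriv a t\<bar> \<le> ?K"
    by (simp add: abs_mult)
  show "\<bar>cut_sine_deriv a m t\<bar> \<le> 5 * ?K"
    using 1 2 3 unfolding cut_sine_deriv_def by linarith
qed

lemma cut_sine_tendsto:
  assumes "0 < t" "t < 1"
  shows "(\<lambda>m. cut_sine a m t) \<longlonglongrightarrow> sine a t" and "(\<lambda>m. cut_sine_deriv a m t) \<longlonglongrightarrow> sine_deriv a t"
proof -
  have "(\<lambda>m. cut_sine a m t) \<longlonglongrightarrow> 1 * 1 * sine a t"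
    unfolding cut_sine_def using assms by (intro tendsto_intros cutoff_tendsto_1) auto
  then show "(\<lambda>m. cut_sine a m t) \<longlonglongrightarrow> sine a t"
    by simp
  have "(\<lambda>m. cut_sine_deriv a m t) \<longlonglongrightarrow> 0 * 1 * sine a t - 1 * 0 * sine a t + 1 * 1 * sine_deriv a t"
    unfolding cut_sine_deriv_def using assms
    by (intro tendsto_intros cutoff_tendsto_1 cutoff_deriv_tendsto_0) auto
  then show "(\<lambda>m. cut_sine_deriv a m t) \<longlonglongrightarrow> sine_deriv a t"
    by simp
qed

lemma test_function_cut_sine:
  fixes \<kappa> :: "nat ^ 'n"
  shows "test_function (tensor (\<lambda>j. cut_sine (\<kappa> $ j) (Suc m)))"
proof (rule test_function_tensor)
  show "smooth_upto k (cut_sine (\<kappa> $ j) (Suc m))" for j k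
    by (rule smooth_upto_cut_sine)
  show "0 < 1 / real (Suc m)"
    by simp
  show "cut_sine (\<kappa> $ j) (Suc m) t = 0" if "t < 1 / real (Suc m)" for j t
    using that cutoff_eq_0[of "Suc m" t] by (simp add: cut_sine_def field_simps)
  show "cut_sine (\<kappa> $ j) (Suc m) t = 0" if "1 - 1 / real (Suc m) < t" for j t
    using that cutoff_eq_0[of "Suc m" "1 - t"] by (simp add: cut_sine_def field_simps)
qed

text \<open>Products of \<open>N\<close> factors bounded by \<open>C\<close> are bounded by \<open>C ^ N\<close>, so dominated convergence
  applies on the cube, which has finite measure.\<close>

lemma tensor_L2_tendsto:
  fixes g :: "'n::finite \<Rightarrow> real \<Rightarrow> real" and G :: "nat \<Rightarrow> 'n \<Rightarrow> real \<Rightarrow> real"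
  assumes cont: "\<And>j. continuous_on UNIV (g j)" "\<And>m j. continuous_on UNIV (G m j)"
    and bound: "\<And>m j t. 0 < t \<Longrightarrow> t < 1 \<Longrightarrow> \<bar>G m j t\<bar> \<le> C"
    and lim: "\<And>j t. 0 < t \<Longrightarrow> t < 1 \<Longrightarrow> (\<lambda>m. G m j t) \<longlonglongrightarrow> g j t"
  shows "(\<lambda>m. L2_sq (\<lambda>x. tensor g x - tensor (G m) x)) \<longlonglongrightarrow> 0"
proof -
  let ?N = "CARD('n)"
  obtain B where B: "\<And>x. x \<in> \<Omega> \<Longrightarrow> norm (tensor g x) \<le> B"
    using continuous_bounded_Omega[OF continuous_tensor[of g, OF cont(1)]] by blast
  have cd: "continuous_on UNIV (\<lambda>x. (norm (tensor g x - tensor (G m) x))\<^sup>2)" for m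
    by (intro continuous_intros continuous_tensor cont)
  have bG: "norm (tensor (G m) x) \<le> C ^ ?N" if "x \<in> \<Omega>" for m x
  proof -
    have "norm (tensor (G m) x) = (\<Prod>j\<in>UNIV. \<bar>G m j (x $ j)\<bar>)"
      by (simp add: tensor_def norm_of_real abs_prod del: of_real_prod)
    also have "\<dots> \<le> (\<Prod>j\<in>(UNIV :: 'n set). C)"
      using that bound by (intro prod_mono) (auto simp: mem_box_cart)
    finally show ?thesis
      by simp
  qed
  have "(\<lambda>m. LINT x|M\<^sub>\<Omega>. (norm (tensor g x - tensor (G m) x))\<^sup>2) \<longlonglongrightarrow> (LINT x|(M\<^sub>\<Omega> :: (real ^ 'n) measure). 0)"
  proof (rule integral_dominated_convergence[where w="\<lambda>x. (B + C ^ ?N)\<^sup>2"])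
    show "(\<lambda>x. (norm (tensor g x - tensor (G m) x))\<^sup>2) \<in> borel_measurable M\<^sub>\<Omega>" for m
      by (rule continuous_measurable_Omega[OF cd])
    show "integrable M\<^sub>\<Omega> (\<lambda>x :: real ^ 'n. (B + C ^ ?N)\<^sup>2)"
      by (intro continuous_integrable_Omega continuous_intros)
    have "norm (tensor g x - tensor (G m) x) \<le> B + C ^ ?N" if "x \<in> \<Omega>" for x m
      using norm_triangle_ineq4[of "tensor g x" "tensor (G m) x"] B[OF that] bG[OF that, of m] by linarith
    then show "AE x in M\<^sub>\<Omega>. norm ((norm (tensor g x - tensor (G m) x))\<^sup>2) \<le> (B + C ^ ?N)\<^sup>2" for m
      by (intro AE_I2) (auto intro!: power_mono)
    have "(\<lambda>m. (norm (tensor g x - tensor (G m) x))\<^sup>2) \<longlonglongrightarrow> (norm (tensor g x - tensor g x))\<^sup>2" if "x \<in> \<Omega>" for x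
      unfolding tensor_def using that by (intro tendsto_intros lim) (auto simp: mem_box_cart)
    then show "AE x in M\<^sub>\<Omega>. (\<lambda>m. (norm (tensor g x - tensor (G m) x))\<^sup>2) \<longlonglongrightarrow> 0"
      by (intro AE_I2) simp
  qed simp
  then show ?thesis
    by (simp add: L2_sq_def)
qed

lemma test_function_scale:
  assumes "test_function f"
  shows "test_function (\<lambda>x. c * f x)"
proof -
  have C: "C_k m f \<Longrightarrow> C_k m (\<lambda>x. c * f x)" for m and f :: "real ^ 'a \<Rightarrow> complex"
  proof (induction m arbitrary: f)
    case 0
    then show ?case
      by (auto intro!: continuous_intros)
  next
    case (Suc m)
    then have d: "f differentiable at x" for x
      by simp
    have "partial j (\<lambda>x. c * f x) = (\<lambda>x. c * partial j f x)" for j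
    proof
      fix x
      have "((\<lambda>x. c * f x) has_derivative (\<lambda>h. c * frechet_derivative f (at x) h)) (at x)"
        by (intro has_derivative_mult_right frechet_derivative_works[THEN iffD1] d)
      from partial_eqI[OF this] show "partial j (\<lambda>x. c * f x) x = c * partial j f x"
        by (simp add: partial_def)
    qed
    then show ?case
      using Suc d by (auto intro!: derivative_intros)
  qed
  have "closure {x. c * f x \<noteq> 0} \<subseteq> closure {x. f x \<noteq> 0}"
    by (intro closure_mono) auto
  then show ?thesis
    using assms C unfolding test_function_def
    by (metis (no_types, lifting) bounded_subset closed_closure compact_eq_bounded_closed dual_order.trans)
qed

lemma L2_sq_scale: "L2_sq (\<lambda>x. c * u x) = (norm c)\<^sup>2 * L2_sq u"
  by (simp add: L2_sq_def norm_mult power_mult_distrib)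

text \<open>The approximants are products of truncated sines. These and their derivatives converge pointwise
  in the open cube and are bounded uniformly, so dominated convergence gives convergence in \<open>H\<^sup>1\<close>.\<close>

lemma e_fun_H10:
  fixes \<kappa> :: "('n::finite) multi_index"
  shows "(\<lambda>x. c * e_fun \<kappa> x) \<in> H10"
proof -
  define f where "f m = tensor (\<lambda>j. cut_sine (\<kappa> $ j) (Suc m))" for m
  define f' where "f' i m = tensor ((\<lambda>j. cut_sine (\<kappa> $ j) (Suc m))(i := cut_sine_deriv (\<kappa> $ i) (Suc m)))" for i m
  have L2: "f m \<in> L2" for m
    unfolding f_def by (intro L2_continuous continuous_tensor continuous_cut_sine)
  have wp: "is_weak_partial i (f m) (f' i m)" for i m
    unfolding f_def f'_def
    by (rule is_weak_partial_tensor[where g'="\<lambda>j. cut_sine_deriv (\<kappa> $ j) (Suc m)"])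
       (rule cut_sine_has_derivative, rule continuous_cut_sine)
  \<comment> \<open>One constant has to dominate the factors for all coordinates and both kinds of factors.\<close>
  define C where "C = sqrt 2 + 5 * (sqrt 2 * (real (\<Sum>j\<in>UNIV. \<kappa> $ j) * pi))"
  have "5 * (sqrt 2 * (real (\<kappa> $ j) * pi)) \<le> 5 * (sqrt 2 * (real (\<Sum>j\<in>UNIV. \<kappa> $ j) * pi))" for j
    by (intro mult_left_mono mult_right_mono) (auto intro!: member_le_sum simp flip: of_nat_sum)
  then have C: "5 * (sqrt 2 * (real (\<kappa> $ j) * pi)) \<le> C" for j
    unfolding C_def by (intro add_increasing) auto
  have "0 \<le> 5 * (sqrt 2 * (real (\<Sum>j\<in>UNIV. \<kappa> $ j) * pi))"
    by (intro mult_nonneg_nonneg) (simp_all del: of_nat_sum)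
  then have C': "sqrt 2 \<le> C"
    unfolding C_def by simp
  have b: "\<bar>cut_sine (\<kappa> $ j) m t\<bar> \<le> C" "\<bar>cut_sine_deriv (\<kappa> $ j) m t\<bar> \<le> C" if "0 < t" "t < 1" for j m t
    using cut_sine_bounds[OF that, of "\<kappa> $ j" m] C[of j] C' by linarith+
  have lim: "(\<lambda>m. L2_sq (\<lambda>x. e_fun \<kappa> x - f m x)) \<longlonglongrightarrow> 0"
    unfolding e_fun_tensor f_def
    by (rule tensor_L2_tendsto[where C=C])
       (auto intro!: continuous_sine continuous_cut_sine b LIMSEQ_Suc[OF cut_sine_tendsto(1)])
  have lim': "(\<lambda>m. L2_sq (\<lambda>x. e_partial i \<kappa> x - f' i m x)) \<longlonglongrightarrow> 0" for i
    unfolding e_partial_def f'_def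
    by (rule tensor_L2_tendsto[where C=C])
       (auto intro!: continuous_sine continuous_cut_sine b LIMSEQ_Suc[OF cut_sine_tendsto(1)]
          LIMSEQ_Suc[OF cut_sine_tendsto(2)])
  have norm: "H1_norm ((\<lambda>x. c * e_fun \<kappa> x) - (\<lambda>x. c * f m x))
      = sqrt ((norm c)\<^sup>2 * L2_sq (\<lambda>x. e_fun \<kappa> x - f m x)
        + (\<Sum>i\<in>UNIV. (norm c)\<^sup>2 * L2_sq (\<lambda>x. e_partial i \<kappa> x - f' i m x)))" for m
  proof -
    have "(\<lambda>x. c * e_fun \<kappa> x) - (\<lambda>x. c * f m x) = (\<lambda>x. c * (e_fun \<kappa> x - f m x))"
      by (auto simp: fun_diff_def algebra_simps)
    moreover have "H1_norm (\<lambda>x. c * (e_fun \<kappa> x - f m x)) = sqrt (L2_sq (\<lambda>x. c * (e_fun \<kappa> x - f m x))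
        + (\<Sum>i\<in>UNIV. L2_sq (\<lambda>x. c * (e_partial i \<kappa> x - f' i m x))))"
      by (intro H1_norm_eq is_weak_partial_scale is_weak_partial_diff is_weak_partial_e_fun wp
            L2_scale L2_diff e_fun_L2 L2)
    ultimately show ?thesis
      by (simp add: L2_sq_scale)
  qed
  have "(\<lambda>m. H1_norm ((\<lambda>x. c * e_fun \<kappa> x) - (\<lambda>x. c * f m x))) \<longlonglongrightarrow>
      sqrt ((norm c)\<^sup>2 * 0 + (\<Sum>i\<in>(UNIV :: 'n set). (norm c)\<^sup>2 * 0))"
    unfolding norm by (intro tendsto_intros lim lim')
  then have "(\<lambda>m. H1_norm ((\<lambda>x. c * e_fun \<kappa> x) - (\<lambda>x. c * f m x))) \<longlonglongrightarrow> 0"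
    by simp
  moreover have "test_function (\<lambda>x. c * f m x)" for m
    unfolding f_def by (intro test_function_scale test_function_cut_sine)
  moreover have "(\<lambda>x. c * e_fun \<kappa> x) \<in> H1"
    using is_weak_partial_scale[OF is_weak_partial_e_fun e_fun_L2] L2_scale[OF e_fun_L2]
    unfolding H1_def by blast
  ultimately show ?thesis
    unfolding H10_def by (auto intro!: exI[of _ "\<lambda>m x. c * f m x"])
qed

section \<open>The enumeration of the spectrum\<close>

lemma finite_sq_sum_le: "finite {\<kappa> :: ('n::finite) multi_index. sq_sum \<kappa> \<le> B}"
proof (rule inj_on_finite)
  show "inj_on (vec_nth :: 'n multi_index \<Rightarrow> _) {\<kappa>. sq_sum \<kappa> \<le> B}"
    by (auto simp: inj_on_def vec_eq_iff)
  have "\<kappa> $ j \<le> B" if "sq_sum \<kappa> \<le> B" for \<kappa> :: "'n multi_index" and j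
  proof -
    have "\<kappa> $ j \<le> (\<kappa> $ j)\<^sup>2"
      by (simp add: power2_nat_le_imp_le)
    also have "\<dots> \<le> sq_sum \<kappa>"
      unfolding sq_sum_def by (rule member_le_sum) auto
    finally show ?thesis
      using that by simp
  qed
  then show "vec_nth ` {\<kappa> :: 'n multi_index. sq_sum \<kappa> \<le> B} \<subseteq> PiE UNIV (\<lambda>_. {..B})"
    by auto
  show "finite (PiE (UNIV :: 'n set) (\<lambda>_. {..B}))"
    by (intro finite_PiE) auto
qed

lemma precedes_irrefl: "\<not> precedes \<kappa> \<kappa>"
  by (simp add: precedes_def)

lemma precedes_trans:
  assumes "precedes \<kappa> \<mu>" "precedes \<mu> \<nu>"
  shows "precedes \<kappa> \<nu>"
proof (cases "sq_sum \<kappa> = sq_sum \<mu> \<and> sq_sum \<mu> = sq_sum \<nu>")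
  case True
  then obtain j k where j: "\<kappa> $ j < \<mu> $ j" "\<forall>i<j. \<kappa> $ i = \<mu> $ i"
    and k: "\<mu> $ k < \<nu> $ k" "\<forall>i<k. \<mu> $ i = \<nu> $ i"
    using assms by (auto simp: precedes_def)
  have "\<kappa> $ min j k < \<nu> $ min j k"
    using j k by (cases j k rule: linorder_cases) (auto simp: min_def)
  moreover have "\<forall>i<min j k. \<kappa> $ i = \<nu> $ i"
    using j k by auto
  ultimately show ?thesis
    using True by (auto simp: precedes_def)
next
  case False
  then show ?thesis
    using assms by (auto simp: precedes_def)
qed

lemma precedes_total:
  assumes "\<kappa> \<noteq> \<mu>"
  shows "precedes \<kappa> \<mu> \<or> precedes \<mu> \<kappa>"
proof -
  let ?D = "{j. \<kappa> $ j \<noteq> \<mu> $ j}"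
  define j where "j = Min ?D"
  have D: "finite ?D" "?D \<noteq> {}"
    using assms by (auto simp: vec_eq_iff)
  have neq: "\<kappa> $ j \<noteq> \<mu> $ j"
    using Min_in[OF D] by (simp add: j_def)
  have eq: "\<kappa> $ i = \<mu> $ i" if "i < j" for i
  proof (rule ccontr)
    assume "\<kappa> $ i \<noteq> \<mu> $ i"
    then have "j \<le> i"
      unfolding j_def by (intro Min_le D) simp
    with that show False
      by simp
  qed
  show ?thesis
  proof (cases "sq_sum \<kappa> = sq_sum \<mu>")
    case True
    then show ?thesis
      using neq eq unfolding precedes_def neq_iff by auto
  qed (auto simp: precedes_def)
qed

text \<open>The function that \<open>nth_multi_index\<close> inverts.\<close>

definition position :: "('n::{finite,linorder}) multi_index \<Rightarrow> nat"
  where "position \<kappa> = card {\<mu> \<in> multi_indices. precedes \<mu> \<kappa>}"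

lemma finite_predecessors: "finite {\<mu> \<in> multi_indices. precedes \<mu> \<kappa>}"
  by (rule finite_subset[OF _ finite_sq_sum_le[of "sq_sum \<kappa>"]]) (auto simp: precedes_def)

lemma position_strict_mono:
  assumes "precedes \<kappa> \<mu>" "\<kappa> \<in> multi_indices"
  shows "position \<kappa> < position \<mu>"
  unfolding position_def
proof (rule psubset_card_mono[OF finite_predecessors])
  show "{\<nu> \<in> multi_indices. precedes \<nu> \<kappa>} \<subset> {\<nu> \<in> multi_indices. precedes \<nu> \<mu>}"
    using assms precedes_trans precedes_irrefl by blast
qed

lemma inj_on_position: "inj_on position multi_indices"
proof (rule inj_onI)
  fix \<kappa> \<mu> :: "'a multi_index"
  assume "\<kappa> \<in> multi_indices" "\<mu> \<in> multi_indices" "position \<kappa> = position \<mu>"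
  then show "\<kappa> = \<mu>"
    using precedes_total[of \<kappa> \<mu>] position_strict_mono[of \<kappa> \<mu>] position_strict_mono[of \<mu> \<kappa>] by auto
qed

text \<open>The predecessors of a multi-index at position \<open>n\<close> occupy \<open>n\<close> distinct positions below \<open>n\<close>, hence
  all of them. So the positions form an initial segment of the natural numbers, which is infinite
  because there are infinitely many multi-indices.\<close>

lemma position_surj: "position ` (multi_indices :: ('n::{finite,linorder}) multi_index set) = UNIV"
proof -
  let ?I = "multi_indices :: 'n multi_index set"
  have "inj (\<lambda>n. (\<chi> j. Suc n) :: 'n multi_index)"
    by (auto simp: inj_def vec_eq_iff)
  then have "infinite (range (\<lambda>n. (\<chi> j. Suc n) :: 'n multi_index))"
    by (rule range_inj_infinite)
  moreover have "range (\<lambda>n. (\<chi> j. Suc n)) \<subseteq> ?I"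
    by (auto simp: multi_indices_def)
  ultimately have "infinite (position ` ?I)"
    using finite_imageD[OF _ inj_on_position] infinite_super by blast
  have "r \<in> position ` ?I" for r
  proof -
    obtain \<kappa> :: "'n multi_index" where \<kappa>: "\<kappa> \<in> multi_indices" "r < position \<kappa>"
      using \<open>infinite (position ` ?I)\<close> unfolding infinite_nat_iff_unbounded by blast
    let ?P = "{\<mu> \<in> multi_indices. precedes \<mu> \<kappa>}"
    have "position ` ?P = {..<position \<kappa>}"
    proof (rule card_subset_eq)
      show "position ` ?P \<subseteq> {..<position \<kappa>}"
        using position_strict_mono by auto
      have "card (position ` ?P) = card ?P"
        by (intro card_image inj_on_subset[OF inj_on_position]) auto
      then show "card (position ` ?P) = card {..<position \<kappa>}"
        by (simp add: position_def)
    qed simp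
    then have "r \<in> position ` ?P"
      using \<kappa>(2) by simp
    then show ?thesis
      by blast
  qed
  then show ?thesis
    by blast
qed

lemma nth_multi_index:
  shows "(nth_multi_index r :: ('n::{finite,linorder}) multi_index) \<in> multi_indices"
    and "position (nth_multi_index r :: 'n multi_index) = r"
proof -
  have "r \<in> position ` (multi_indices :: 'n multi_index set)"
    by (simp add: position_surj)
  then have "\<exists>!\<kappa> :: 'n multi_index. \<kappa> \<in> multi_indices \<and> card {\<mu> \<in> multi_indices. precedes \<mu> \<kappa>} = r"
    using inj_on_position unfolding position_def[symmetric] inj_on_def by blast
  from theI'[OF this] show "(nth_multi_index r :: 'n multi_index) \<in> multi_indices"
      "position (nth_multi_index r :: 'n multi_index) = r"
    by (auto simp: nth_multi_index_def position_def)
qed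

lemma mode_index_mem: "mode_index k \<in> multi_indices"
  unfolding mode_index_def by (rule nth_multi_index)

lemma mode_inj:
  assumes "k \<ge> 1" "l \<ge> 1"
    and "(mode_index k :: ('n::{finite,linorder}) multi_index) = mode_index l" "mode_sign k = mode_sign l"
  shows "k = l"
proof -
  have "(k - 1) div 2 = (l - 1) div 2"
    using assms(3) nth_multi_index(2) unfolding mode_index_def by metis
  moreover have "odd k \<longleftrightarrow> odd l"
    using assms(4) by (auto simp: mode_sign_def split: if_splits)
  then have "(k - 1) mod 2 = (l - 1) mod 2"
    using assms(1,2) by (simp add: mod2_eq_if)
  ultimately have "k - 1 = l - 1"
    by (metis div_mult_mod_eq)
  with assms(1,2) show ?thesis
    by simp
qed

lemma mode_sign: "mode_sign k \<in> {1, -1}"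
  by (simp add: mode_sign_def)

lemma abs_omega:
  assumes "\<alpha> \<ge> 0"
  shows "\<bar>\<omega> TYPE('n::{finite,linorder}) \<alpha> k\<bar> = sqrt (pi\<^sup>2 * real (sq_sum (mode_index k :: 'n multi_index)) + \<alpha>)"
proof -
  have "0 \<le> pi\<^sup>2 * real (sq_sum (mode_index k :: 'n multi_index)) + \<alpha>"
    using assms by simp
  then show ?thesis
    using mode_sign[of k] by (auto simp: \<omega>_def eigenvalue_def branch_eigenvalue_def abs_mult)
qed

lemma eigenvalue_eq: "eigenvalue TYPE('n::{finite,linorder}) \<alpha> k = \<i> * of_real (\<omega> TYPE('n) \<alpha> k)"
  by (simp add: complex_eq_iff \<omega>_def eigenvalue_def branch_eigenvalue_def)

text \<open>Only finitely many multi-indices have a bounded sum of squares, and the enumeration is injective.\<close>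

lemma omega_at_top:
  assumes "\<alpha> \<ge> 0"
  shows "filterlim (\<lambda>k. \<bar>\<omega> TYPE('n::{finite,linorder}) \<alpha> k\<bar>) at_top sequentially"
  unfolding filterlim_at_top
proof
  fix Z :: real
  define B where "B = nat \<lceil>Z\<^sup>2\<rceil>"
  have "inj (nth_multi_index :: nat \<Rightarrow> 'n multi_index)"
    by (rule injI) (metis nth_multi_index(2))
  from finite_vimageI[OF finite_sq_sum_le this, of B]
  obtain R where R: "\<And>r. sq_sum (nth_multi_index r :: 'n multi_index) \<le> B \<Longrightarrow> r \<le> R"
    by (auto simp: finite_nat_set_iff_bounded_le)
  \<comment> \<open>From \<open>k = 2 R + 3\<close> on, the multi-index number \<open>(k - 1) div 2\<close> exceeds \<open>R\<close>.\<close>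
  have "Z \<le> \<bar>\<omega> TYPE('n) \<alpha> k\<bar>" if "k \<ge> 2 * R + 3" for k
  proof -
    have "R < (k - 1) div 2"
      using that by linarith
    then have "B < sq_sum (mode_index k :: 'n multi_index)"
      using R unfolding mode_index_def by (metis leD leI)
    moreover have "Z\<^sup>2 \<le> real B"
      unfolding B_def by linarith
    moreover have "1 * real (sq_sum (mode_index k :: 'n multi_index))
        \<le> pi\<^sup>2 * real (sq_sum (mode_index k :: 'n multi_index))"
      using pi_gt3 by (intro mult_right_mono one_le_power) auto
    ultimately have "Z\<^sup>2 \<le> pi\<^sup>2 * real (sq_sum (mode_index k :: 'n multi_index)) + \<alpha>"
      using assms by linarith
    then show ?thesis
      unfolding abs_omega[OF assms] by (rule real_le_rsqrt)
  qed
  then show "\<forall>\<^sub>F k in sequentially. Z \<le> \<bar>\<omega> TYPE('n) \<alpha> k\<bar>"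
    by (auto simp: eventually_sequentially)
qed

section \<open>Functions of the operator on eigenvectors\<close>

lemma eigenvectors_orthonormal:
  assumes "\<alpha> \<ge> 0" "k \<ge> 1" "l \<ge> 1"
  shows "E_inner \<alpha> (eigenvector \<alpha> k :: ('n::{finite,linorder}) state) (eigenvector \<alpha> l) = (if k = l then 1 else 0)"
  unfolding eigenvector_def E_inner_eigenvectors[OF assms(1) mode_index_mem mode_index_mem mode_sign mode_sign]
  using mode_inj[OF assms(2,3), where 'n='n] by auto

lemma scaled_eigenvector_mem: "E_scale c (eigenvector \<alpha> k :: ('n::{finite,linorder}) state) \<in> \<E>"
proof -
  obtain p q where "eigenvector \<alpha> k = ((\<lambda>x. p * e_fun (mode_index k :: 'n multi_index) x), (\<lambda>x. q * e_fun (mode_index k) x))"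
    unfolding eigenvector_def branch_eigenvector_eq by blast
  then have "E_scale c (eigenvector \<alpha> k) = ((\<lambda>x. (c * p) * e_fun (mode_index k :: 'n multi_index) x), (\<lambda>x. (c * q) * e_fun (mode_index k) x))"
    by (simp add: E_scale_def mult.assoc)
  then show ?thesis
    unfolding \<E>_def using e_fun_H10 L2_scale[OF e_fun_L2] by auto
qed

lemma E_scale_0: "E_scale 0 \<Psi> = 0"
  by (simp add: E_scale_def zero_prod_def func_zero)

lemma E_scale_1: "E_scale 1 \<Psi> = \<Psi>"
  by (simp add: E_scale_def)

lemma eigenvector_mem: "eigenvector \<alpha> k \<in> \<E>"
  using scaled_eigenvector_mem[of 1 \<alpha> k] by (simp add: E_scale_1)

lemma E_norm_0: "E_norm \<alpha> (0 :: ('n::finite) state) = 0"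
proof -
  have L: "(\<lambda>x. 0) \<in> (L2 :: (real ^ 'n \<Rightarrow> complex) set)"
    by (intro L2_continuous continuous_intros)
  then have "is_weak_partial j (\<lambda>x. 0) (\<lambda>x. 0)" for j :: 'n
    by (simp add: is_weak_partial_def)
  from E_norm_eq[of "\<lambda>x. 0" "\<lambda>_ x. 0" "\<lambda>x. 0" \<alpha>, OF this L L] show ?thesis
    by (simp add: zero_prod_def func_zero L2_sq_def)
qed

text \<open>On an eigenvector the spectral series has a single nonzero term by orthonormality, so its partial
  sums are eventually constant and the series converges in the energy space. The chosen value then
  agrees with this term up to energy norm \<open>0\<close>.\<close>

lemma spectral_op_eigenvector:
  fixes h :: "complex \<Rightarrow> complex"
  assumes "\<alpha> \<ge> 0" "k \<ge> 1"
  defines "\<phi> \<equiv> (eigenvector \<alpha> k :: ('n::{finite,linorder}) state)"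
  shows "spectral_op \<alpha> h \<phi> \<in> \<E>"
    and "E_norm \<alpha> (spectral_op \<alpha> h \<phi> - E_scale (h (eigenvalue TYPE('n) \<alpha> k)) \<phi>) = 0"
proof -
  let ?c = "h (eigenvalue TYPE('n) \<alpha> k)"
  define S where "S m = (\<Sum>j=1..m. E_scale (h (eigenvalue TYPE('n) \<alpha> j) * E_inner \<alpha> \<phi> (eigenvector \<alpha> j))
      (eigenvector \<alpha> j :: 'n state))" for m
  have S: "S m = E_scale ?c \<phi>" if "m \<ge> k" for m
  proof -
    have "S m = (\<Sum>j=1..m. if j = k then E_scale ?c \<phi> else 0)"
      unfolding S_def using assms(1,2)
      by (intro sum.cong refl) (auto simp: \<phi>_def eigenvectors_orthonormal E_scale_0)
    also have "\<dots> = E_scale ?c \<phi>"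
      using that assms(2) by (subst sum.delta) auto
    finally show ?thesis .
  qed
  then have ev: "\<forall>\<^sub>F m in sequentially. E_norm \<alpha> (\<Phi> - S m) = E_norm \<alpha> (\<Phi> - E_scale ?c \<phi>)" for \<Phi>
    by (auto simp: eventually_sequentially intro!: exI[of _ k])
  have "E_scale ?c \<phi> \<in> \<E> \<and> (\<lambda>m. E_norm \<alpha> (E_scale ?c \<phi> - S m)) \<longlonglongrightarrow> 0"
    using scaled_eigenvector_mem ev[of "E_scale ?c \<phi>"] by (auto simp: \<phi>_def E_norm_0 intro: tendsto_eventually)
  then have *: "spectral_op \<alpha> h \<phi> \<in> \<E> \<and> (\<lambda>m. E_norm \<alpha> (spectral_op \<alpha> h \<phi> - S m)) \<longlonglongrightarrow> 0"
    unfolding spectral_op_def S_def by (rule someI)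
  then show "spectral_op \<alpha> h \<phi> \<in> \<E>"
    by simp
  have "(\<lambda>m. E_norm \<alpha> (spectral_op \<alpha> h \<phi> - S m)) \<longlonglongrightarrow> E_norm \<alpha> (spectral_op \<alpha> h \<phi> - E_scale ?c \<phi>)"
    using ev by (rule tendsto_eventually)
  with * show "E_norm \<alpha> (spectral_op \<alpha> h \<phi> - E_scale ?c \<phi>) = 0"
    using LIMSEQ_unique by blast
qed

text \<open>The operator acts on a normalised eigenvector as multiplication by the value of its symbol, so
  testing with the eigenvectors bounds the operator norm from below.\<close>

lemma op_norm_spectral_diff_ge:
  fixes h f :: "complex \<Rightarrow> complex"
  assumes "\<alpha> \<ge> 0" "k \<ge> 1"
  shows "ennreal (norm (h (eigenvalue TYPE('n::{finite,linorder}) \<alpha> k) - f (eigenvalue TYPE('n) \<alpha> k)))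
    \<le> op_norm \<alpha> (\<lambda>\<Psi> :: 'n state. spectral_op \<alpha> h \<Psi> - spectral_op \<alpha> f \<Psi>)"
proof -
  let ?\<phi> = "eigenvector \<alpha> k :: 'n state"
  let ?h = "spectral_op \<alpha> h ?\<phi>" and ?f = "spectral_op \<alpha> f ?\<phi>"
  have H: "fst \<Psi> \<in> H1" "snd \<Psi> \<in> L2" if "\<Psi> \<in> \<E>" for \<Psi> :: "'n state"
    using that by (auto simp: \<E>_def H10_def)
  have norm_\<phi>: "E_norm \<alpha> ?\<phi> = 1"
    by (simp add: E_norm_def eigenvectors_orthonormal[OF assms assms(2)])
  have "E_norm \<alpha> (?h - ?f) = norm (h (eigenvalue TYPE('n) \<alpha> k) - f (eigenvalue TYPE('n) \<alpha> k)) * E_norm \<alpha> ?\<phi>"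
    by (rule E_norm_diff_of_multiples[of "fst ?h" "fst ?f" "fst ?\<phi>" "snd ?h" "snd ?f" "snd ?\<phi>",
          unfolded prod.collapse])
       (intro H spectral_op_eigenvector assms eigenvector_mem)+
  moreover have "ennreal (E_norm \<alpha> (?h - ?f)) \<le> op_norm \<alpha> (\<lambda>\<Psi> :: 'n state. spectral_op \<alpha> h \<Psi> - spectral_op \<alpha> f \<Psi>)"
    unfolding op_norm_def by (rule SUP_upper) (simp add: eigenvector_mem norm_\<phi>)
  ultimately show ?thesis
    by (simp add: norm_\<phi>)
qed

section \<open>The Crank--Nicolson scheme\<close>

text \<open>The amplification factor is \<open>2 / (1 + \<lambda> dt / 2) - 1\<close>, and the denominator is unbounded along the
  spectrum. The scheme thus treats all very high frequencies as if the phase per step were \<open>pi\<close>.\<close>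

lemma amplification_tendsto:
  assumes "\<alpha> \<ge> 0" "dt > 0"
  shows "(\<lambda>k. (1 - eigenvalue TYPE('n::{finite,linorder}) \<alpha> k * of_real dt / 2)
      / (1 + eigenvalue TYPE('n) \<alpha> k * of_real dt / 2)) \<longlonglongrightarrow> -1"
proof -
  let ?d = "\<lambda>k. 1 + eigenvalue TYPE('n) \<alpha> k * of_real dt / 2"
  have "Re (?d k) = 1" "Im (?d k) = \<omega> TYPE('n) \<alpha> k * (dt / 2)" for k
    by (simp_all add: eigenvalue_eq)
  then have nz: "?d k \<noteq> 0" and "\<bar>\<omega> TYPE('n) \<alpha> k\<bar> * (dt / 2) \<le> norm (?d k)" for k
    using abs_Im_le_cmod[of "?d k"] assms(2) by (auto simp: abs_mult complex_eq_iff)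
  moreover have "filterlim (\<lambda>k. \<bar>\<omega> TYPE('n) \<alpha> k\<bar> * (dt / 2)) at_top sequentially"
    using filterlim_tendsto_pos_mult_at_top[OF tendsto_const _ omega_at_top[OF assms(1), where 'n='n], of "dt / 2"] assms(2)
    by (simp add: mult.commute)
  ultimately have "filterlim (\<lambda>k. norm (?d k)) at_top sequentially"
    by (auto intro: filterlim_at_top_mono)
  then have "filterlim ?d at_infinity sequentially"
    by (rule filterlim_norm_at_top_imp_at_infinity)
  then have "(\<lambda>k. 2 / ?d k - 1) \<longlonglongrightarrow> 0 - 1"
    by (intro tendsto_intros tendsto_divide_0[OF tendsto_const])
  moreover have "2 / ?d k - 1 = (1 - eigenvalue TYPE('n) \<alpha> k * of_real dt / 2) / ?d k" for k
  proof -
    have "2 / ?d k - 1 = (2 - ?d k) / ?d k"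
      using divide_diff_eq_iff[OF nz[of k], of 2 1] by simp
    then show ?thesis
      by simp
  qed
  ultimately show ?thesis
    by simp
qed

text \<open>For a mode of very high frequency the symbol of \<open>n\<close> steps is close to \<open>(-1) ^ n\<close>, and that of
  \<open>n + 1\<close> steps to the opposite sign, whereas both are compared with the same number
  \<open>exp (- T \<lambda>)\<close>. By the triangle inequality the two errors add up to almost the distance \<open>2\<close> of the signs.\<close>

lemma op_norm_consecutive_ge:
  fixes \<alpha> T :: real
  assumes "\<alpha> \<ge> 0" "T > 0" "n \<ge> 1"
  defines "err \<equiv> \<lambda>n. op_norm \<alpha> (\<lambda>\<Psi> :: ('n::{finite,linorder}) state. crank_nicolson \<alpha> (T / real n) n \<Psi> - exact_flow \<alpha> T \<Psi>)"
  shows "2 \<le> err n + err (Suc n)"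
proof -
  define R where "R n k = (1 - eigenvalue TYPE('n) \<alpha> k * of_real (T / real n) / 2)
      / (1 + eigenvalue TYPE('n) \<alpha> k * of_real (T / real n) / 2)" for n k
  have lower: "ennreal (norm (R n k ^ n - R (Suc n) k ^ Suc n)) \<le> err n + err (Suc n)" if "k \<ge> 1" for k
  proof -
    let ?e = "exp (- of_real T * eigenvalue TYPE('n) \<alpha> k)"
    have le: "ennreal (norm (R m k ^ m - ?e)) \<le> err m" for m
      using op_norm_spectral_diff_ge[OF assms(1) that, where 'n='n]
      unfolding err_def crank_nicolson_def exact_flow_def R_def by fast
    have "norm (R n k ^ n - R (Suc n) k ^ Suc n) \<le> norm (R n k ^ n - ?e) + norm (R (Suc n) k ^ Suc n - ?e)"
      using norm_triangle_ineq4[of "R n k ^ n - ?e" "R (Suc n) k ^ Suc n - ?e"] by simp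
    then have "ennreal (norm (R n k ^ n - R (Suc n) k ^ Suc n))
        \<le> ennreal (norm (R n k ^ n - ?e)) + ennreal (norm (R (Suc n) k ^ Suc n - ?e))"
      by (simp add: ennreal_leI flip: ennreal_plus)
    also have "\<dots> \<le> err n + err (Suc n)"
      by (intro add_mono le)
    finally show ?thesis .
  qed
  have "(\<lambda>k. R m k) \<longlonglongrightarrow> -1" if "m \<ge> 1" for m
    unfolding R_def using assms that by (intro amplification_tendsto) auto
  then have "(\<lambda>k. norm (R n k ^ n - R (Suc n) k ^ Suc n)) \<longlonglongrightarrow> norm ((-1) ^ n - (-1) ^ Suc n :: complex)"
    using assms(3) by (intro tendsto_intros) auto
  also have "norm ((-1) ^ n - (-1) ^ Suc n :: complex) = 2"
    by (cases "even n") auto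
  finally have "(\<lambda>k. ennreal (norm (R n k ^ n - R (Suc n) k ^ Suc n))) \<longlonglongrightarrow> ennreal 2"
    by (rule tendsto_ennrealI)
  then have "ennreal 2 \<le> err n + err (Suc n)"
    by (rule LIMSEQ_le_const2) (use lower in auto)
  then show ?thesis
    by simp
qed

theorem proposition21:
  fixes \<alpha> T :: real
  assumes "\<alpha> \<ge> 0" and "T > 0"
  shows
    "(\<forall>dt>0. \<forall>k\<ge>1. \<omega>\<^sub>h TYPE('n::{finite,linorder}) \<alpha> dt k \<in> {- (pi / dt)<..<pi / dt})
      \<and> filterlim (\<lambda>k. \<bar>\<omega> TYPE('n) \<alpha> k\<bar>) at_top sequentially
      \<and> (\<forall>dt>0. filterlim (\<lambda>k. \<bar>\<omega> TYPE('n) \<alpha> k - \<omega>\<^sub>h TYPE('n) \<alpha> dt k\<bar>) at_top sequentially)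
      \<and> \<not> (\<lambda>n. op_norm \<alpha> (\<lambda>\<Psi> :: 'n state.
              crank_nicolson \<alpha> (T / real n) n \<Psi> - exact_flow \<alpha> T \<Psi>)) \<longlonglongrightarrow> 0"
proof (intro conjI allI impI)
  show band: "\<omega>\<^sub>h TYPE('n) \<alpha> dt k \<in> {- (pi / dt)<..<pi / dt}" if "dt > 0" for dt k
  proof -
    have "2 / dt * arctan y < 2 / dt * (pi / 2)" "2 / dt * (- (pi / 2)) < 2 / dt * arctan y" for y
      using that arctan_lbound[of y] arctan_ubound[of y] by (intro mult_strict_left_mono; simp)+
    then show ?thesis
      by (simp add: \<omega>\<^sub>h_def)
  qed
  show top: "filterlim (\<lambda>k. \<bar>\<omega> TYPE('n) \<alpha> k\<bar>) at_top sequentially"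
    by (rule omega_at_top[OF assms(1)])
  show "filterlim (\<lambda>k. \<bar>\<omega> TYPE('n) \<alpha> k - \<omega>\<^sub>h TYPE('n) \<alpha> dt k\<bar>) at_top sequentially" if "dt > 0" for dt
  proof (rule filterlim_at_top_mono)
    show "filterlim (\<lambda>k. - (pi / dt) + \<bar>\<omega> TYPE('n) \<alpha> k\<bar>) at_top sequentially"
      by (rule filterlim_tendsto_add_at_top[OF tendsto_const top])
    have "- (pi / dt) + \<bar>\<omega> TYPE('n) \<alpha> k\<bar> \<le> \<bar>\<omega> TYPE('n) \<alpha> k - \<omega>\<^sub>h TYPE('n) \<alpha> dt k\<bar>" for k
      using band[OF that, of k] by auto
    then show "\<forall>\<^sub>F k in sequentially. - (pi / dt) + \<bar>\<omega> TYPE('n) \<alpha> k\<bar> \<le> \<bar>\<omega> TYPE('n) \<alpha> k - \<omega>\<^sub>h TYPE('n) \<alpha> dt k\<bar>"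
      by simp
  qed
  let ?err = "\<lambda>n. op_norm \<alpha> (\<lambda>\<Psi> :: 'n state. crank_nicolson \<alpha> (T / real n) n \<Psi> - exact_flow \<alpha> T \<Psi>)"
  show "\<not> ?err \<longlonglongrightarrow> 0"
  proof
    assume "?err \<longlonglongrightarrow> 0"
    then have "(\<lambda>n. ?err n + ?err (Suc n)) \<longlonglongrightarrow> 0 + 0"
      by (intro tendsto_add LIMSEQ_Suc)
    moreover have "\<exists>N. \<forall>n\<ge>N. 2 \<le> ?err n + ?err (Suc n)"
      using op_norm_consecutive_ge[OF assms] by blast
    ultimately have "2 \<le> (0 + 0 :: ennreal)"
      by (rule LIMSEQ_le_const)
    then show False
      by simp
  qed
qed

end
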